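(* Suppose that $\beta\ne0$ and that the function $\chi$ vanishes in a neighborhood of $0$. Then there exist a sequence $(u_j)_{j\ge0}$ of elements of $\mathcal H_{ph}\otimes\mathcal H_{sp}=\mathcal F_s(H_{\mathbb C})\otimes\mathcal H_{sp}$, independent of $h$, and a sequence of real numbers $(\lambda_j)_{j\ge1}$ with $$u_0=\Psi_0\otimes a_\emptyset,\qquad\lambda_1=-N|\beta|,$$ such that for every integer $p\ge0$ there is a constant $C$ with, for all $h\in(0,1)$, $$\Big\|\big(H(h)-(\lambda_1h+\cdots+\lambda_{p+1}h^{p+1})\big)\Big[\sum_{j=0}^{2p}u_jh^{j/2}\Big]\Big\|\le C\,h^{p+3/2},$$ $$\Big\|\big(H(h)-(\lambda_1h+\cdots+\lambda_{p+1}h^{p+1})\big)\Big[\sum_{j=0}^{2p+1}u_jh^{j/2}\Big]\Big\|\le C\,h^{p+2}.$$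
   Context: $H$ is the real Hilbert space of $f=(f_1,f_2,f_3):\mathbb R^3\to\mathbb R^3$ with $f_j\in L^2(\mathbb R^3)$ real valued and $k\cdot f(k)=0$ a.e., with the $L^2$ norm; $H_{\mathbb C}$ is its complexification; $\mathcal F_s(H_{\mathbb C})$ is the symmetric Fock space; $\Psi_0$ is its vacuum (a unit vector of the $0$-particle sector). $M$ is multiplication by $|k|$. $\Phi_S(f)=2^{-1/2}(a(f)+a^*(f))$ is the Segal field ($a^*(f)$ creation operator, linear in $f\in H_{\mathbb C}$). $\chi\in\mathcal S(\mathbb R)$ is real valued; $(e_1,e_2,e_3)$ is the canonical basis of $\mathbb R^3$; $\wedge$ is the cross product; for $x\in\mathbb R^3$, $m=1,2,3$, $$a_m(x)(k)=\frac{\chi(|k|)|k|^{1/2}}{(2\pi)^{3/2}}\sin(k\cdot x)\frac{k\wedge e_m}{|k|},\qquad b_m(x)(k)=\frac{\chi(|k|)|k|^{1/2}}{(2\pi)^{3/2}}\cos(k\cdot x)\frac{k\wedge e_m}{|k|}.$$ $x_1,\dots,x_N\in\mathbb R^3$ and $\beta=(\beta_1,\beta_2,\beta_3)\in\mathbb R^3$ are fixed; $\mathcal H_{sp}=(\mathbb C^2)^{\otimes N}$; $\sigma_m^{[\lambda]}$ is the Pauli matrix $\sigma_m$ acting on the $\lambda$-th factor. In the Fock representation the Hamiltonian is $$H(h)=h\Big(d\Gamma(M)\otimes I+I\otimes\sum_{\lambda,m}\beta_m\sigma_m^{[\lambda]}\Big)+h^{3/2}\sum_{\lambda=1}^N\sum_{m=1}^3\Phi_S(a_m(x_\lambda)+ib_m(x_\lambda))\otimes\sigma_m^{[\lambda]}.$$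 $b_0\in\mathbb C^2$ is a unit vector with $\sum_m\beta_m\sigma_mb_0=-|\beta|b_0$, and $a_\emptyset=b_0\otimes\cdots\otimes b_0\in\mathcal H_{sp}$. *)

theory Defs
  imports "HOL-Analysis.Analysis" "HOL-Analysis.Cross3"
begin

text \<open>
  The one-photon space \<open>H\<^sub>C\<close> is a closed subspace of \<open>L\<^sup>2(\<real>\<^sup>3; \<complex>\<^sup>3)\<close>, that is of
  \<open>L\<^sup>2(\<real>\<^sup>3 \<times> {1,2,3}; \<complex>)\<close>: a pair \<open>(k, i)\<close> is a momentum with a component index, and
  \<open>f (k, i)\<close> is the \<open>i\<close>-th component of \<open>f(k)\<close>.
\<close>

type_synonym photon = "(real ^ 3) \<times> 3"

definition photon_measure :: "photon measure" where
  "photon_measure = lborel \<Otimes>\<^sub>M count_space UNIV"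

definition transverse :: "(photon \<Rightarrow> complex) \<Rightarrow> bool" where
  "transverse f \<longleftrightarrow> (AE k in lborel. (\<Sum>i\<in>UNIV. of_real (k $ i) * f (k, i)) = 0)"

text \<open>
  The \<open>n\<close>-fold Hilbert tensor power of \<open>L\<^sup>2(\<real>\<^sup>3 \<times> {1,2,3})\<close> is
  \<open>L\<^sup>2((\<real>\<^sup>3 \<times> {1,2,3})\<^sup>n)\<close>; inside it, the tensor power of \<open>H\<^sub>C\<close> consists of the functions
  that are transverse in each variable.  Its elements are represented by Borel functions rather than
  by classes modulo null sets.  For \<open>n = 0\<close> the measure is a point mass, so that the
  \<open>0\<close>-particle sector is \<open>\<complex>\<close>.
\<close>

definition photons_measure :: "nat \<Rightarrow> (nat \<Rightarrow> photon) measure" where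
  "photons_measure n = PiM {..<n} (\<lambda>_. photon_measure)"

type_synonym fock = "nat \<Rightarrow> (nat \<Rightarrow> photon) \<Rightarrow> complex"

definition fock_norm2 :: "fock \<Rightarrow> ennreal" where
  "fock_norm2 u = (\<Sum>n. \<integral>\<^sup>+K. ennreal ((cmod (u n K))\<^sup>2) \<partial>photons_measure n)"

definition fock_space :: "fock set" where
  "fock_space = {u. (\<forall>n. u n \<in> borel_measurable (photons_measure n) \<and>
        (\<forall>\<pi>. \<pi> permutes {..<n} \<longrightarrow> (AE K in photons_measure n. u n (K \<circ> \<pi>) = u n K)) \<and>
        (\<forall>j<n. AE K in photons_measure n. transverse (\<lambda>q. u n (K(j := q))))) \<and>
      fock_norm2 u < \<infinity>}"

definition vacuum :: fock where
  "vacuum n K = (if n = 0 then 1 else 0)"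

text \<open>
  All operators below are given by their action on each sector and considered on their maximal domain,
  that is, on the \<open>u\<close> in the Fock space that they map into the Fock space.  For \<open>\<Phi>\<^sub>S(f)\<close> and for the
  second quantization of a real multiplication operator this is the usual self-adjoint operator.

  In an element \<open>K\<close> of the space of \<open>photons_measure n\<close>, \<open>K i\<close> is \<open>undefined\<close> for \<open>i \<ge> n\<close>;
  removing the entry \<open>j\<close> from \<open>K\<close> or prepending an entry to it, as is done below, respects this.
\<close>

definition creation :: "(photon \<Rightarrow> complex) \<Rightarrow> fock \<Rightarrow> fock" where
  "creation f u n K =
     of_real (1 / sqrt (real n)) *
       (\<Sum>j<n. f (K j) * u (n - 1) (\<lambda>i. K (if i < j then i else Suc i)))"

definition annihilation :: "(photon \<Rightarrow> complex) \<Rightarrow> fock \<Rightarrow> fock" where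
  "annihilation f u n K =
     of_real (sqrt (real n + 1)) *
       (\<integral>q. cnj (f q) * u (Suc n) (case_nat q K) \<partial>photon_measure)"

definition segal :: "(photon \<Rightarrow> complex) \<Rightarrow> fock \<Rightarrow> fock" where
  "segal f u n K = of_real (1 / sqrt 2) * (annihilation f u n K + creation f u n K)"

text \<open>Second quantization: \<open>A\<close> acts successively on each of the variables.\<close>

definition dGamma :: "((photon \<Rightarrow> complex) \<Rightarrow> (photon \<Rightarrow> complex)) \<Rightarrow> fock \<Rightarrow> fock" where
  "dGamma A u n K = (\<Sum>j<n. A (\<lambda>q. u n (K(j := q))) (K j))"

definition mult_abs :: "(photon \<Rightarrow> complex) \<Rightarrow> (photon \<Rightarrow> complex)" where
  "mult_abs f = (\<lambda>(k, i). of_real (norm k) * f (k, i))"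

text \<open>
  The spins are indexed by a finite type \<open>'n\<close> with \<open>N = CARD('n)\<close>, and \<open>(\<complex>\<^sup>2)\<^bsup>\<otimes>N\<^esup>\<close> is
  \<open>complex ^ ('n \<Rightarrow> 2)\<close>, the coordinates being those in the tensor product basis.
  Elements of \<open>F \<otimes> (\<complex>\<^sup>2)\<^bsup>\<otimes>N\<^esup>\<close>, with \<open>F\<close> the Fock space, are likewise represented by
  their coordinates in \<open>F\<close> with respect to this basis.
\<close>

definition pauli :: "3 \<Rightarrow> complex ^ 2 ^ 2" where
  "pauli m =
     (if m = 1 then vector [vector [0, 1], vector [1, 0]]
      else if m = 2 then vector [vector [0, - \<i>], vector [\<i>, 0]]
      else vector [vector [1, 0], vector [0, - 1]])"

definition pauli_at :: "'n::finite \<Rightarrow> 3 \<Rightarrow> complex ^ ('n \<Rightarrow> 2) ^ ('n \<Rightarrow> 2)" where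
  "pauli_at l m = (\<chi> s t. \<Prod>\<mu>\<in>UNIV. (if \<mu> = l then pauli m else mat 1) $ s \<mu> $ t \<mu>)"

definition spin_power :: "complex ^ 2 \<Rightarrow> complex ^ ('n::finite \<Rightarrow> 2)" where
  "spin_power b = (\<chi> s. \<Prod>\<mu>\<in>UNIV. b $ s \<mu>)"

type_synonym 'n state = "('n \<Rightarrow> 2) \<Rightarrow> fock"

definition state_space :: "('n::finite) state set" where
  "state_space = {\<psi>. \<forall>s. \<psi> s \<in> fock_space}"

definition state_norm :: "('n::finite) state \<Rightarrow> real" where
  "state_norm \<psi> = sqrt (enn2real (\<Sum>s\<in>UNIV. fock_norm2 (\<psi> s)))"

definition tensor_vec :: "fock \<Rightarrow> complex ^ ('n::finite \<Rightarrow> 2) \<Rightarrow> 'n state" where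
  "tensor_vec u v s n K = v $ s * u n K"

definition tensor_op ::
    "(fock \<Rightarrow> fock) \<Rightarrow> complex ^ ('n::finite \<Rightarrow> 2) ^ ('n \<Rightarrow> 2) \<Rightarrow> 'n state \<Rightarrow> 'n state" where
  "tensor_op A B \<psi> s n K = (\<Sum>t\<in>UNIV. B $ s $ t * A (\<psi> t) n K)"

definition schwartz :: "(real \<Rightarrow> real) \<Rightarrow> bool" where
  "schwartz f \<longleftrightarrow>
     (\<forall>n x. ((deriv ^^ n) f) differentiable (at x)) \<and>
     (\<forall>m n. bounded (range (\<lambda>x. x ^ m * (deriv ^^ n) f x)))"

definition mode_a :: "(real \<Rightarrow> real) \<Rightarrow> 3 \<Rightarrow> real ^ 3 \<Rightarrow> real ^ 3 \<Rightarrow> real ^ 3" where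
  "mode_a cutoff m x k =
     (cutoff (norm k) * sqrt (norm k) / (2 * pi) powr (3/2) * sin (k \<bullet> x)) *\<^sub>R
       (cross3 k (axis m 1) /\<^sub>R norm k)"

definition mode_b :: "(real \<Rightarrow> real) \<Rightarrow> 3 \<Rightarrow> real ^ 3 \<Rightarrow> real ^ 3 \<Rightarrow> real ^ 3" where
  "mode_b cutoff m x k =
     (cutoff (norm k) * sqrt (norm k) / (2 * pi) powr (3/2) * cos (k \<bullet> x)) *\<^sub>R
       (cross3 k (axis m 1) /\<^sub>R norm k)"

text \<open>The element \<open>f + \<i> g\<close> of \<open>H\<^sub>C\<close>, for \<open>f\<close> and \<open>g\<close> in the real space \<open>H\<close>.\<close>

definition complexify :: "(real ^ 3 \<Rightarrow> real ^ 3) \<Rightarrow> (real ^ 3 \<Rightarrow> real ^ 3) \<Rightarrow> photon \<Rightarrow> complex" where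
  "complexify f g = (\<lambda>(k, i). of_real (f k $ i) + \<i> * of_real (g k $ i))"

definition field_at ::
    "(real \<Rightarrow> real) \<Rightarrow> ('n::finite \<Rightarrow> real ^ 3) \<Rightarrow> 'n \<Rightarrow> 3 \<Rightarrow> 'n state \<Rightarrow> 'n state" where
  "field_at cutoff x l m =
     tensor_op (segal (complexify (mode_a cutoff m (x l)) (mode_b cutoff m (x l)))) (pauli_at l m)"

definition hamiltonian ::
    "(real \<Rightarrow> real) \<Rightarrow> real ^ 3 \<Rightarrow> ('n::finite \<Rightarrow> real ^ 3) \<Rightarrow> real \<Rightarrow> 'n state \<Rightarrow> 'n state" where
  "hamiltonian cutoff \<beta> x h \<psi> s n K =
     of_real h *
       (tensor_op (dGamma mult_abs) (mat 1) \<psi> s n K +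
        tensor_op (\<lambda>u. u) (\<Sum>l\<in>UNIV. \<Sum>m\<in>UNIV. \<beta> $ m *\<^sub>R pauli_at l m) \<psi> s n K) +
     of_real (h powr (3/2)) * (\<Sum>l\<in>UNIV. \<Sum>m\<in>UNIV. field_at cutoff x l m \<psi> s n K)"

text \<open>
  The domain of the sum.  As the field operators are relatively bounded with respect to
  \<open>d\<Gamma>(M) \<otimes> I\<close>, it coincides with the domain of the latter; it does not depend on \<open>h > 0\<close>.
\<close>

definition hamiltonian_domain ::
    "(real \<Rightarrow> real) \<Rightarrow> ('n::finite \<Rightarrow> real ^ 3) \<Rightarrow> 'n state set" where
  "hamiltonian_domain cutoff x =
     {\<psi> \<in> state_space. tensor_op (dGamma mult_abs) (mat 1) \<psi> \<in> state_space \<and>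
        (\<forall>l m. field_at cutoff x l m \<psi> \<in> state_space)}"

definition partial_state :: "(nat \<Rightarrow> 'n state) \<Rightarrow> nat \<Rightarrow> real \<Rightarrow> 'n state" where
  "partial_state u J h s n K = (\<Sum>j\<le>J. of_real (h powr (real j / 2)) * u j s n K)"

definition residual ::
    "(real \<Rightarrow> real) \<Rightarrow> real ^ 3 \<Rightarrow> ('n::finite \<Rightarrow> real ^ 3) \<Rightarrow> real \<Rightarrow> real \<Rightarrow> 'n state \<Rightarrow> 'n state" where
  "residual cutoff \<beta> x h E \<psi> s n K = hamiltonian cutoff \<beta> x h \<psi> s n K - of_real E * \<psi> s n K"

end

theory Submission
  imports Defs "HOL-Library.Function_Algebras" "HOL-Probability.Sinc_Integral"
begin

text \<open>
  Put \<open>s = h\<^sup>1\<^sup>/\<^sup>2\<close>. Then \<open>H(h) = s\<^sup>2 (\<lambda>\<^sub>1 + A + s B)\<close> with \<open>A\<close> the free Hamiltonian, shifted so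
  that \<open>u\<^sub>0\<close> spans its kernel, and \<open>B\<close> the field coupling, and one solves
  \<open>(A + s B) \<psi>(s) = \<mu>(s) \<psi>(s)\<close> as formal power series in \<open>s\<close>. As \<open>B\<close> changes the number of photons
  by one, \<open>\<mu>\<close> is even in \<open>s\<close>; as \<open>A\<close> and \<open>B\<close> are symmetric, it is real. The spectrum of \<open>A\<close> has no
  gap at \<open>0\<close>, but all vectors that occur are dominated, pointwise and on finitely many sectors, by
  products \<open>g(k\<^sub>1) \<cdots> g(k\<^sub>n)\<close> of one square integrable weight \<open>g\<close> that vanishes for \<open>\<bar>k\<bar> < \<epsilon>\<close>. This
  class is stable under \<open>B\<close> and under the reduced resolvent of \<open>A\<close>, which on it is multiplication by
  a bounded function once the spin part is diagonalised.
\<close>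

section \<open>Formal perturbation theory with a reduced resolvent\<close>

text \<open>At order \<open>j + 1\<close> the equation asks for a preimage under \<open>A\<close> of
  a combination of earlier terms minus \<open>B\<close> of the last one. The equation is solvable
  only if this combination is orthogonal to the ground state. Taking all later terms orthogonal to
  the ground state turns the condition into an explicit formula for the next eigenvalue coefficient.
  That formula is not manifestly real, hence the separate argument with quadratic forms. The
  obstacle is that \<open>A\<close> contains an unbounded multiplication by the total photon energy,
  which can destroy domination by the fixed weight \<open>g\<close>. So nothing below asks
  \<open>A\<close> to preserve the class. The images of the constructed vectors lie in it all the
  same, because the equations express them by vectors of the class; this also yields membership in
  the domain of the Hamiltonian without estimates on moments. What replaces the gap is that a vector
  of the class is nonzero only where the total energy is 0 (no photon) or at least
  \<open>\<epsilon>\<close>. With no photon only the spin gap matters, and it is positive because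
  \<open>\<beta> \<noteq> 0\<close>. Evenness of the eigenvalue series is what removes half-integer
  powers of \<open>h\<close> from the energy while they remain in the vectors.\<close>

lemma sum_triangle_swap:
  fixes f :: "nat \<Rightarrow> nat \<Rightarrow> 'b::comm_monoid_add"
  shows "(\<Sum>b\<le>j. \<Sum>i\<le>b. f i (j - b)) = (\<Sum>i\<le>j. \<Sum>a\<le>j - i. f i a)"
proof -
  have "(\<Sum>b\<le>j. \<Sum>i\<le>b. f i (j - b)) = (\<Sum>(b, i)\<in>Sigma {..j} (\<lambda>b. {..b}). f i (j - b))"
    by (simp add: sum.Sigma)
  also have "\<dots> = (\<Sum>(i, a)\<in>Sigma {..j} (\<lambda>i. {..j - i}). f i a)"
    by (rule sum.reindex_bij_witness[where i = "\<lambda>(i, a). (j - a, i)" and j = "\<lambda>(b, i). (i, j - b)"])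
      auto
  finally show ?thesis by (simp add: sum.Sigma)
qed

text \<open>Conjugation exchanges the terms \<open>b\<close> and \<open>j - b\<close>. Such sums are
  the coefficients of a quadratic form of a symmetric operator, evaluated on a formal series with
  real parameter.\<close>

lemma hermitian_convolution_real:
  fixes g :: "nat \<Rightarrow> nat \<Rightarrow> complex"
  assumes "\<And>a b. g b a = cnj (g a b)"
  shows "(\<Sum>b\<le>j. g (j - b) b) \<in> \<real>"
proof -
  have "cnj (\<Sum>b\<le>j. g (j - b) b) = (\<Sum>b\<le>j. g b (j - b))"
    by (simp add: assms[symmetric])
  also have "\<dots> = (\<Sum>b\<le>j. g (j - b) b)"
    by (rule sum.reindex_bij_witness[where i = "\<lambda>b. j - b" and j = "\<lambda>b. j - b"]) auto
  finally show ?thesis by (simp add: Reals_cnj_iff)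
qed

text \<open>\<open>R\<close> is a right inverse of \<open>A\<close> on the complement of
  \<open>e\<close> and takes its values in that complement; \<open>P\<close> is a grading under
  which \<open>A\<close>'s inverse is even and \<open>B\<close> is odd. There is deliberately no
  axiom that \<open>A\<close> maps \<open>X\<close> to itself, which is why \<open>A_sym\<close> has
  to hold for all vectors.\<close>

locale formal_perturbation = vector_space scale
  for scale :: "complex \<Rightarrow> 'v::ab_group_add \<Rightarrow> 'v" (infixr \<open>*\<^sub>C\<close> 75) +
  fixes X :: "'v set" and ip :: "'v \<Rightarrow> 'v \<Rightarrow> complex" and A B R P :: "'v \<Rightarrow> 'v" and e :: 'v
  assumes X: "subspace X" and e: "e \<in> X"
    and ip_add: "\<And>u v w. u \<in> X \<Longrightarrow> v \<in> X \<Longrightarrow> w \<in> X \<Longrightarrow> ip u (v + w) = ip u v + ip u w"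
    and ip_scale: "\<And>c u v. u \<in> X \<Longrightarrow> v \<in> X \<Longrightarrow> ip u (c *\<^sub>C v) = c * ip u v"
    and ip_cnj: "\<And>u v. u \<in> X \<Longrightarrow> v \<in> X \<Longrightarrow> ip v u = cnj (ip u v)"
    and ip_e: "ip e e = 1"
    and A_add: "\<And>u v. A (u + v) = A u + A v"
    and A_scale: "\<And>c u. A (c *\<^sub>C u) = c *\<^sub>C A u"
    and A_sym: "\<And>u v. ip (A u) v = ip u (A v)"
    and A_e: "A e = 0"
    and B_in: "\<And>u. u \<in> X \<Longrightarrow> B u \<in> X"
    and B_add: "\<And>u v. u \<in> X \<Longrightarrow> v \<in> X \<Longrightarrow> B (u + v) = B u + B v"
    and B_scale: "\<And>c u. B (c *\<^sub>C u) = c *\<^sub>C B u"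
    and B_sym: "\<And>u v. u \<in> X \<Longrightarrow> v \<in> X \<Longrightarrow> ip (B u) v = ip u (B v)"
    and R_in: "\<And>w. w \<in> X \<Longrightarrow> R w \<in> X"
    and R_scale: "\<And>c w. R (c *\<^sub>C w) = c *\<^sub>C R w"
    and A_R: "\<And>w. w \<in> X \<Longrightarrow> ip e w = 0 \<Longrightarrow> A (R w) = w"
    and e_R: "\<And>w. w \<in> X \<Longrightarrow> ip e (R w) = 0"
    and P_add: "\<And>u v. P (u + v) = P u + P v"
    and P_scale: "\<And>c u. P (c *\<^sub>C u) = c *\<^sub>C P u"
    and P_B: "\<And>u. P (B u) = - B (P u)"
    and P_R: "\<And>u. P (R u) = R (P u)"
    and P_e: "P e = e"
    and ip_P: "\<And>u v. ip (P u) (P v) = ip u v"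
begin

lemmas X_simps = subspace_0[OF X] subspace_add[OF X] subspace_scale[OF X] subspace_diff[OF X]

lemma X_sum: "(\<And>i. i \<in> I \<Longrightarrow> f i \<in> X) \<Longrightarrow> sum f I \<in> X"
  using subspace_sum[OF X] .

lemma ip_0: "u \<in> X \<Longrightarrow> ip u 0 = 0"
  using ip_scale[of u 0 0] X_simps(1) by simp

lemma ip_diff:
  assumes "u \<in> X" "v \<in> X" "w \<in> X"
  shows "ip u (v - w) = ip u v - ip u w"
  using ip_add[OF assms(1) subspace_diff[OF X assms(2,3)] assms(3)] by simp

lemma ip_sum:
  assumes "u \<in> X" "\<And>i. i \<in> I \<Longrightarrow> f i \<in> X"
  shows "ip u (sum f I) = (\<Sum>i\<in>I. ip u (f i))"
  using assms(2)
  by (induction I rule: infinite_finite_induct) (simp_all add: ip_0 ip_add assms(1) X_sum)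

lemma A_sum: "A (sum f I) = (\<Sum>i\<in>I. A (f i))"
  using A_scale[of 0 0] by (induction I rule: infinite_finite_induct) (simp_all add: A_add)

lemma P_sum: "P (sum f I) = (\<Sum>i\<in>I. P (f i))"
  using P_scale[of 0 0] by (induction I rule: infinite_finite_induct) (simp_all add: P_add)

lemma P_diff: "P (u - v) = P u - P v"
  using P_add[of "u - v" v] by simp

text \<open>Coefficient of \<open>s ^ Suc j\<close> in the eigenvalue equation, solved for the
  newest vector. The eigenvalue coefficients are written out as \<open>ip e (B (pert i))\<close> so
  that the recursion is closed; \<open>corr\<close> names them afterwards.\<close>

function pert :: "nat \<Rightarrow> 'v" where
  "pert 0 = e"
| "pert (Suc j) = R ((\<Sum>i\<in>{..j}. ip e (B (pert i)) *\<^sub>C pert (j - i)) - B (pert j))"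
  by pat_completeness auto
termination by (relation "inv_image less_than id") auto

declare pert.simps(2) [simp del]

text \<open>The coefficients of the eigenvalue series of \<open>A + s B\<close>. The constant one is
  0 because \<open>A e = 0\<close>.\<close>

definition corr :: "nat \<Rightarrow> complex" where
  "corr j = (case j of 0 \<Rightarrow> 0 | Suc i \<Rightarrow> ip e (B (pert i)))"

lemma corr_0 [simp]: "corr 0 = 0" and corr_Suc: "corr (Suc j) = ip e (B (pert j))"
  by (simp_all add: corr_def)

lemma pert_Suc: "pert (Suc j) = R ((\<Sum>i\<le>j. corr (Suc i) *\<^sub>C pert (j - i)) - B (pert j))"
  by (simp add: corr_Suc pert.simps(2))

lemma pert_in: "pert j \<in> X"
proof (induction j rule: less_induct)
  case (less j)
  then show ?case
    by (cases j) (auto simp: e pert_Suc intro!: R_in B_in X_simps X_sum)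
qed

lemma rhs_in: "(\<Sum>i\<le>j. corr (Suc i) *\<^sub>C pert (j - i)) - B (pert j) \<in> X"
  by (intro X_simps X_sum B_in pert_in)

lemma ip_e_pert: "ip e (pert j) = (if j = 0 then 1 else 0)"
  by (cases j) (simp_all add: ip_e pert_Suc e_R[OF rhs_in])

text \<open>Solvability: by \<open>ip_e_pert\<close> only the summand \<open>i = j\<close> has a
  component along \<open>e\<close>, and its coefficient \<open>corr (Suc j)\<close> is exactly the
  one that cancels the component of \<open>B (pert j)\<close>.\<close>

lemma A_pert_Suc: "A (pert (Suc j)) = (\<Sum>i\<le>j. corr (Suc i) *\<^sub>C pert (j - i)) - B (pert j)"
proof -
  have "ip e ((\<Sum>i\<le>j. corr (Suc i) *\<^sub>C pert (j - i)) - B (pert j)) =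
      (\<Sum>i\<le>j. corr (Suc i) * (if j - i = 0 then 1 else 0)) - corr (Suc j)"
    by (simp add: ip_diff ip_sum ip_scale ip_e_pert e pert_in B_in X_simps X_sum corr_Suc)
  also have "(\<Sum>i\<le>j. corr (Suc i) * (if j - i = 0 then 1 else 0)) = (\<Sum>i\<in>{j}. corr (Suc i))"
    by (rule sum.mono_neutral_cong_right) auto
  finally show ?thesis
    unfolding pert_Suc by (intro A_R rhs_in) simp
qed

text \<open>Not a property of \<open>A\<close>: the equation just solved rewrites the image in terms
  of vectors of \<open>X\<close>.\<close>

lemma A_pert_in: "A (pert j) \<in> X"
  using rhs_in by (cases j) (auto simp: A_e X_simps A_pert_Suc)

text \<open>Both claims are proved in one induction, since the sign of \<open>pert j\<close> depends
  on the vanishing of the odd coefficients up to and including \<open>corr j\<close>, and the latter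
  on the sign of the preceding vector.\<close>

lemma parity:
  "P (pert j) = (-1) ^ j *\<^sub>C pert j \<and> (odd j \<longrightarrow> corr j = 0)"
proof (induction j rule: less_induct)
  case (less j)
  show ?case
  proof (cases j)
    case 0
    then show ?thesis by (simp add: P_e)
  next
    case (Suc k)
    have PB: "P (B (pert k)) = (-1) ^ j *\<^sub>C B (pert k)"
      using less.IH[of k] by (simp add: Suc P_B B_scale scale_minus_left)
    \<comment> \<open>\<open>P\<close> fixes \<open>e\<close> and preserves \<open>ip\<close>, while
      it multiplies \<open>B (pert k)\<close> by \<open>(-1) ^ j\<close>.\<close>
    have *: "corr j = (-1) ^ j * corr j"
      using ip_P[of e "B (pert k)"] by (simp add: PB P_e ip_scale e B_in pert_in Suc corr_Suc del: power_Suc)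
    have odd: "odd j \<longrightarrow> corr j = 0"
      using * by auto
    \<comment> \<open>A summand with odd \<open>Suc i\<close> vanishes; \<open>i = k\<close> is the
      case of \<open>corr j\<close> itself, settled by \<open>odd\<close>. For even
      \<open>Suc i\<close> the indices \<open>k - i\<close> and \<open>j\<close> have the same
      parity.\<close>
    have "P (corr (Suc i) *\<^sub>C pert (k - i)) = (-1) ^ j *\<^sub>C (corr (Suc i) *\<^sub>C pert (k - i))"
      if "i \<le> k" for i
    proof (cases "odd (Suc i)")
      case True
      then have "corr (Suc i) = 0"
        using that odd less.IH[of "Suc i"] Suc by (cases "i = k") auto
      then show ?thesis using P_scale[of 0 0] by simp
    next
      case False
      then have "(-1::complex) ^ j = (-1) ^ (k - i)"
        using that Suc by (auto simp: minus_one_power_iff)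
      then show ?thesis
        using less.IH[of "k - i"] Suc by (simp add: P_scale mult.commute)
    qed
    then have "P ((\<Sum>i\<le>k. corr (Suc i) *\<^sub>C pert (k - i)) - B (pert k)) =
        (-1) ^ j *\<^sub>C ((\<Sum>i\<le>k. corr (Suc i) *\<^sub>C pert (k - i)) - B (pert k))"
      by (simp add: P_diff P_sum PB scale_right_diff_distrib scale_sum_right)
    then have "P (pert j) = (-1) ^ j *\<^sub>C pert j"
      by (simp only: Suc pert_Suc P_R R_scale)
    with odd show ?thesis by blast
  qed
qed

lemmas corr_odd = parity[THEN conjunct2, rule_format]

text \<open>
  The \<open>j\<close>-th coefficient of the identity
  \<open>\<langle>\<psi>(s), (A + s B) \<psi>(s)\<rangle> = \<mu>(s) \<langle>\<psi>(s), \<psi>(s)\<rangle>\<close> between formal power series in \<open>s\<close>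
  expresses \<open>corr j\<close> by the previous ones and by real numbers.
\<close>
lemma corr_real: "corr j \<in> \<real>"
proof (induction j rule: less_induct)
  case (less j)
  show ?case
  proof (cases j)
    case 0
    then show ?thesis by simp
  next
    case (Suc k)
    \<comment> \<open>\<open>N r\<close>, \<open>a\<close> and \<open>c\<close> are coefficients of
      the quadratic forms of the identity, of \<open>A\<close> and of \<open>B\<close> on the formal
      eigenvector: at orders \<open>r\<close>, \<open>j\<close> and \<open>k\<close>, the last being
      shifted by the factor \<open>s\<close> in front of \<open>B\<close>.\<close>
    define N where "N r = (\<Sum>a\<le>r. ip (pert (r - a)) (pert a))" for r
    have N: "N r \<in> \<real>" for r
      unfolding N_def by (rule hermitian_convolution_real[of "\<lambda>a b. ip (pert a) (pert b)"]) (intro ip_cnj pert_in)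
    define a where "a = (\<Sum>b\<le>j. ip (pert (j - b)) (A (pert b)))"
    have a: "a \<in> \<real>"
      unfolding a_def
      by (rule hermitian_convolution_real[of "\<lambda>a b. ip (pert a) (A (pert b))"]) (metis ip_cnj A_sym pert_in A_pert_in)
    define c where "c = (\<Sum>b\<le>k. ip (pert (k - b)) (B (pert b)))"
    have c: "c \<in> \<real>"
      unfolding c_def
      by (rule hermitian_convolution_real[of "\<lambda>a b. ip (pert a) (B (pert b))"]) (metis ip_cnj B_sym B_in pert_in)
    have "a = (\<Sum>b\<le>k. ip (pert (k - b)) (A (pert (Suc b))))"
      unfolding a_def Suc by (subst sum.atMost_Suc_shift) (simp add: A_e ip_0 pert_in)
    also have "\<dots> = (\<Sum>b\<le>k. \<Sum>i\<le>b. corr (Suc i) * ip (pert (k - b)) (pert (b - i))) - c"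
      by (simp add: A_pert_Suc ip_diff ip_sum ip_scale pert_in B_in X_simps X_sum c_def
          sum_subtractf)
    also have "(\<Sum>b\<le>k. \<Sum>i\<le>b. corr (Suc i) * ip (pert (k - b)) (pert (b - i))) =
        (\<Sum>b\<le>k. \<Sum>i\<le>b. corr (Suc i) * ip (pert (k - b)) (pert (k - i - (k - b))))"
      by (intro sum.cong refl arg_cong2[where f = "(*)"] arg_cong2[where f = ip]
          arg_cong[where f = pert]) auto
    \<comment> \<open>Both double sums run over the pairs with \<open>i + a \<le> k\<close>; in the
      new order the factor of each \<open>corr (Suc i)\<close> is a norm coefficient.\<close>
    also have "\<dots> = (\<Sum>i\<le>k. \<Sum>a\<le>k - i. corr (Suc i) * ip (pert a) (pert (k - i - a)))"
      by (rule sum_triangle_swap)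
    also have "\<dots> = (\<Sum>i\<le>k. corr (Suc i) * cnj (N (k - i)))"
      unfolding N_def by (auto simp: sum_distrib_left ip_cnj[OF pert_in pert_in, symmetric] intro!: sum.cong)
    also have "\<dots> = (\<Sum>i\<le>k. corr (Suc i) * N (k - i))"
      using N by (simp add: Reals_cnj_iff)
    \<comment> \<open>The last summand has the factor \<open>N 0 = ip e e = 1\<close>, which
      isolates \<open>corr j\<close>.\<close>
    also have "\<dots> = (\<Sum>i<k. corr (Suc i) * N (k - i)) + corr j"
      by (simp add: lessThan_Suc_atMost[symmetric] N_def Suc ip_e)
    finally have "corr j = a + c - (\<Sum>i<k. corr (Suc i) * N (k - i))"
      by (simp add: algebra_simps)
    moreover have "(\<Sum>i<k. corr (Suc i) * N (k - i)) \<in> \<real>"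
      by (intro sum_in_Reals Reals_mult less.IH N) (simp add: Suc)
    ultimately show ?thesis
      using a c by simp
  qed
qed

text \<open>In the product of the truncated series all pairs with \<open>i + j \<le> J\<close>
  cancel against \<open>A\<close> and \<open>B\<close> by the recursion. What is left are the pairs
  beyond order \<open>J\<close> and the top term of \<open>B\<close>. Keeping the remaining powers
  of \<open>s\<close> explicit, with nonnegative exponents, gives coefficients that are bounded for
  \<open>s\<close> in \<open>[0, 1]\<close>.\<close>

lemma residual_expansion:
  fixes s :: complex
  defines "\<psi> J \<equiv> \<Sum>j\<le>J. s ^ j *\<^sub>C pert j"
  shows "A (\<psi> J) + s *\<^sub>C B (\<psi> J) - (\<Sum>i\<le>J. corr i * s ^ i) *\<^sub>C \<psi> J =
    s ^ Suc J *\<^sub>C (B (pert J) -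
      (\<Sum>(i, j)\<in>{(i, j). i \<le> J \<and> j \<le> J \<and> J < i + j}.
        (corr i * s ^ (i + j - Suc J)) *\<^sub>C pert j))"
proof -
  let ?c = "\<lambda>(i, j). (corr i * s ^ (i + j)) *\<^sub>C pert j"
  let ?D = "{(i, j). i \<le> J \<and> j \<le> J \<and> J < i + j}"
  let ?E = "{(i, j). i + j \<le> J}"
  have fin: "finite ?D" "finite ?E"
    by (rule finite_subset[of _ "{..J} \<times> {..J}"]; auto)+
  have "(\<Sum>i\<le>J. corr i * s ^ i) *\<^sub>C \<psi> J = (\<Sum>p\<in>{..J} \<times> {..J}. ?c p)"
    unfolding \<psi>_def scale_sum_left
    by (simp add: scale_sum_right sum.cartesian_product power_add mult_ac)
  also have "{..J} \<times> {..J} = ?D \<union> ?E" by auto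
  also have "(\<Sum>p\<in>?D \<union> ?E. ?c p) = (\<Sum>p\<in>?D. ?c p) + (\<Sum>p\<in>?E. ?c p)"
    by (rule sum.union_disjoint[OF fin]) auto
  also have "(\<Sum>p\<in>?D. ?c p) = s ^ Suc J *\<^sub>C
      (\<Sum>(i, j)\<in>?D. (corr i * s ^ (i + j - Suc J)) *\<^sub>C pert j)"
    unfolding scale_sum_right
  proof (intro sum.cong refl, clarify)
    fix i j assume "J < i + j"
    then have "i + j = Suc J + (i + j - Suc J)"
      by simp
    then have "s ^ (i + j) = s ^ Suc J * s ^ (i + j - Suc J)"
      by (metis power_add)
    then show "(corr i * s ^ (i + j)) *\<^sub>C pert j =
        s ^ Suc J *\<^sub>C (corr i * s ^ (i + j - Suc J)) *\<^sub>C pert j"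
      by (simp add: mult_ac del: power_Suc)
  qed
  finally have low: "(\<Sum>i\<le>J. corr i * s ^ i) *\<^sub>C \<psi> J =
      s ^ Suc J *\<^sub>C (\<Sum>(i, j)\<in>?D. (corr i * s ^ (i + j - Suc J)) *\<^sub>C pert j) + (\<Sum>p\<in>?E. ?c p)" .
  have "A (\<psi> J) + s *\<^sub>C B (\<psi> J) = s ^ Suc J *\<^sub>C B (pert J) + (\<Sum>p\<in>{(i, j). i + j \<le> J}. ?c p)"
  proof (induction J)
    case 0
    have "{(i, j). i + j \<le> (0::nat)} = {(0, 0)}" by auto
    then show ?case by (simp add: \<psi>_def A_e)
  next
    case (Suc J)
    \<comment> \<open>The new pairs form the diagonal \<open>i + j = Suc J\<close>. The pair in
      \<open>?T\<close> contributes nothing because \<open>corr 0 = 0\<close>, and those in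
      \<open>?S\<close> are the sum in \<open>A_pert_Suc\<close>.\<close>
    let ?S = "(\<lambda>i. (Suc i, J - i)) ` {..J}"
    let ?T = "{(0::nat, Suc J)}"
    have *: "{(i, j). i + j \<le> Suc J} = {(i, j). i + j \<le> J} \<union> (?S \<union> ?T)"
    proof (intro equalityI subsetI)
      fix p assume "p \<in> {(i, j). i + j \<le> Suc J}"
      then obtain i j where p: "p = (i, j)" "i + j \<le> Suc J" by auto
      show "p \<in> {(i, j). i + j \<le> J} \<union> (?S \<union> ?T)"
      proof (cases "i + j \<le> J \<or> i = 0")
        case True then show ?thesis using p by auto
      next
        case False
        then have "p = (Suc (i - 1), J - (i - 1))" "i - 1 \<le> J" using p by auto
        then show ?thesis by blast
      qed
    qed auto
    have fin: "finite {(i, j). i + j \<le> J}"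
      by (rule finite_subset[of _ "{..J} \<times> {..J}"]) auto
    have "(\<Sum>p\<in>{(i, j). i + j \<le> Suc J}. ?c p) =
        (\<Sum>p\<in>{(i, j). i + j \<le> J}. ?c p) + ((\<Sum>p\<in>?S. ?c p) + (\<Sum>p\<in>?T. ?c p))"
      unfolding * using fin by (subst sum.union_disjoint; (subst sum.union_disjoint)?) auto
    also have "(\<Sum>p\<in>?S. ?c p) = s ^ Suc J *\<^sub>C (\<Sum>i\<le>J. corr (Suc i) *\<^sub>C pert (J - i))"
      by (subst sum.reindex) (auto simp: inj_on_def scale_sum_right mult_ac intro!: sum.cong)
    also have "(\<Sum>p\<in>?T. ?c p) = 0" by simp
    also have "(\<Sum>i\<le>J. corr (Suc i) *\<^sub>C pert (J - i)) = A (pert (Suc J)) + B (pert J)"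
      by (simp add: A_pert_Suc)
    finally have **: "(\<Sum>p\<in>{(i, j). i + j \<le> Suc J}. ?c p) =
      (\<Sum>p\<in>{(i, j). i + j \<le> J}. ?c p) + s ^ Suc J *\<^sub>C (A (pert (Suc J)) + B (pert J))" by simp
    have "\<psi> J \<in> X"
      unfolding \<psi>_def by (intro X_sum X_simps pert_in)
    then have "A (\<psi> (Suc J)) + s *\<^sub>C B (\<psi> (Suc J)) = (A (\<psi> J) + s *\<^sub>C B (\<psi> J)) +
        s ^ Suc J *\<^sub>C A (pert (Suc J)) + s ^ Suc (Suc J) *\<^sub>C B (pert (Suc J))"
      unfolding \<psi>_def
      by (simp add: A_add A_scale B_add B_scale pert_in X_simps scale_right_distrib)
    then show ?case
      unfolding ** Suc.IH by (simp add: scale_right_distrib del: power_Suc)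
  qed
  then show ?thesis
    unfolding low by (simp add: scale_right_diff_distrib del: power_Suc)
qed

end

section \<open>Inserting and removing a photon\<close>

text \<open>The increasing enumeration of the indices other than \<open>j\<close>, through which
  \<open>creation\<close> reads its argument.\<close>

definition skip :: "nat \<Rightarrow> nat \<Rightarrow> nat" where
  "skip j i = (if i < j then i else Suc i)"

definition insert_at :: "nat \<Rightarrow> 'a \<Rightarrow> (nat \<Rightarrow> 'a) \<Rightarrow> nat \<Rightarrow> 'a" where
  "insert_at j q K i = (if i < j then K i else if i = j then q else K (i - 1))"

text \<open>With multisets, inserting a photon at one position or at another gives equal
  \<open>entries\<close>, so for symmetric functions any variable can be moved to the front without
  handling permutations.\<close>

definition entries :: "nat \<Rightarrow> (nat \<Rightarrow> 'a) \<Rightarrow> 'a multiset" where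
  "entries n K = image_mset K (mset_set {..<n})"

lemma insert_at_skip [simp]: "insert_at j q K (skip j i) = K i"
  and insert_at_same [simp]: "insert_at j q K j = q"
  by (auto simp: insert_at_def skip_def)

lemma inj_skip: "inj (skip j)"
  by (auto simp: inj_on_def skip_def split: if_splits)

lemma lessThan_Suc_skip:
  assumes "j \<le> n"
  shows "{..<Suc n} = insert j (skip j ` {..<n})"
proof (intro equalityI subsetI)
  fix i assume i: "i \<in> {..<Suc n}"
  consider "i = j" | "i = skip j i" "i < j" | "i = skip j (i - 1)" "j < i"
    by (cases "i < j"; cases "i = j") (auto simp: skip_def)
  then show "i \<in> insert j (skip j ` {..<n})"
  proof cases
    case 2
    then show ?thesis using assms by (intro insertI2 image_eqI[of _ _ i]) auto
  next
    case 3
    then show ?thesis using i by (intro insertI2 image_eqI[of _ _ "i - 1"]) auto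
  qed simp
qed (use assms in \<open>auto simp: skip_def\<close>)

lemma skip_neq: "j \<noteq> skip j i"
  by (auto simp: skip_def)

lemma prod_lessThan_Suc_skip:
  assumes "j \<le> n"
  shows "(\<Prod>i<Suc n. f i) = f j * (\<Prod>i<n. f (skip j i))"
  unfolding lessThan_Suc_skip[OF assms]
  by (subst prod.insert) (auto simp: skip_neq prod.reindex[OF inj_on_subset[OF inj_skip]])

lemma entries_skip:
  assumes "j \<le> n"
  shows "entries (Suc n) K = add_mset (K j) (entries n (\<lambda>i. K (skip j i)))"
proof -
  have "mset_set {..<Suc n} = add_mset j (image_mset (skip j) (mset_set {..<n}))"
    unfolding lessThan_Suc_skip[OF assms]
    by (subst mset_set.insert) (auto simp: skip_neq image_mset_mset_set[OF inj_on_subset[OF inj_skip]])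
  then show ?thesis
    by (simp add: entries_def multiset.map_comp comp_def)
qed

lemma entries_insert_at:
  "j \<le> n \<Longrightarrow> entries (Suc n) (insert_at j q K) = add_mset q (entries n K)"
  by (simp add: entries_skip)

lemma case_nat_eq_insert_at: "case_nat q K = insert_at 0 q K"
  by (auto simp: insert_at_def fun_eq_iff split: nat.split)

lemma entries_case_nat: "entries (Suc n) (case_nat q K) = add_mset q (entries n K)"
  unfolding case_nat_eq_insert_at by (rule entries_insert_at) simp

lemma sum_entries: "(\<Sum>j<n. f (K j)) = (\<Sum>q\<in>#entries n K. f q)"
  by (simp add: entries_def sum_unfold_sum_mset multiset.map_comp comp_def)

lemma entries_permute: "\<pi> permutes {..<n} \<Longrightarrow> entries n (K \<circ> \<pi>) = entries n K"
  unfolding entries_def multiset.map_comp[symmetric]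
  by (simp add: image_mset_mset_set permutes_inj_on permutes_image)

lemma skip_Suc_case_nat: "(\<lambda>i. case_nat q K (skip (Suc j) i)) = case_nat q (\<lambda>i. K (skip j i))"
  by (auto simp: skip_def fun_eq_iff split: nat.split)

section \<open>Product measures and the separation of one variable\<close>

lemma space_photon_measure [simp]: "space photon_measure = UNIV"
  by (simp add: photon_measure_def space_pair_measure)

interpretation photon: sigma_finite_measure photon_measure
proof -
  interpret pair_sigma_finite "lborel :: (real ^ 3) measure" "count_space (UNIV :: 3 set)"
    by (intro pair_sigma_finite.intro sigma_finite_lborel sigma_finite_measure_count_space_finite)
      simp
  show "sigma_finite_measure photon_measure"
    unfolding photon_measure_def by (rule sigma_finite_measure_axioms)
qed

interpretation photons: product_sigma_finite "\<lambda>_::nat. photon_measure"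
  by unfold_locales

lemma sigma_finite_photons: "sigma_finite_measure (photons_measure n)"
  unfolding photons_measure_def by (rule photons.sigma_finite) simp

lemma space_photons_measure: "space (photons_measure n) = extensional {..<n}"
  by (auto simp: photons_measure_def space_PiM PiE_def)

lemma measurable_component [measurable]:
  "j < n \<Longrightarrow> (\<lambda>K. K j) \<in> photons_measure n \<rightarrow>\<^sub>M photon_measure"
  unfolding photons_measure_def by (rule measurable_component_singleton) simp

lemma measurable_skip [measurable]:
  assumes "j \<le> n"
  shows "(\<lambda>K i. K (skip j i)) \<in> photons_measure (Suc n) \<rightarrow>\<^sub>M photons_measure n"
  unfolding photons_measure_def
proof (rule measurable_PiM_single')
  show "(\<lambda>K. K (skip j i)) \<in> PiM {..<Suc n} (\<lambda>_. photon_measure) \<rightarrow>\<^sub>M photon_measure"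
    if "i \<in> {..<n}" for i
    using that by (intro measurable_component_singleton) (auto simp: skip_def)
qed (use assms in \<open>auto simp: space_PiM PiE_def extensional_def skip_def\<close>)

lemma measurable_insert_at [measurable]:
  assumes "j \<le> n"
  shows "(\<lambda>(q, K). insert_at j q K) \<in> photon_measure \<Otimes>\<^sub>M photons_measure n \<rightarrow>\<^sub>M photons_measure (Suc n)"
  unfolding photons_measure_def split_beta
proof (rule measurable_PiM_single')
  have snd: "(\<lambda>p. snd p i) \<in> photon_measure \<Otimes>\<^sub>M PiM {..<n} (\<lambda>_. photon_measure) \<rightarrow>\<^sub>M photon_measure"
    if "i < n" for i
    by (rule measurable_compose[OF measurable_snd measurable_component_singleton]) (use that in simp)
  show "(\<lambda>p. insert_at j (fst p) (snd p) i)
      \<in> photon_measure \<Otimes>\<^sub>M PiM {..<n} (\<lambda>_. photon_measure) \<rightarrow>\<^sub>M photon_measure"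
    if "i \<in> {..<Suc n}" for i
  proof -
    consider "i = j" | "i < j" | "j < i" by linarith
    then show ?thesis
      using snd[of i] snd[of "i - 1"] that assms by cases (simp_all add: insert_at_def)
  qed
qed (use assms in \<open>auto simp: space_PiM space_pair_measure PiE_def extensional_def insert_at_def\<close>)

text \<open>The preimage of a box is the side \<open>A j\<close> times the box of the remaining
  sides, so uniqueness of the product measure applies. This allows Fubini with an arbitrary variable
  \<open>j\<close> singled out.\<close>

lemma distr_insert_at:
  assumes "j \<le> n"
  shows "distr (photon_measure \<Otimes>\<^sub>M photons_measure n) (photons_measure (Suc n))
    (\<lambda>(q, K). insert_at j q K) = photons_measure (Suc n)" (is "?D = _")
proof -
  interpret N: sigma_finite_measure "photons_measure n" by (rule sigma_finite_photons)
  have "?D = PiM {..<Suc n} (\<lambda>_. photon_measure)"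
  proof (rule photons.PiM_eqI)
    fix A :: "nat \<Rightarrow> photon set" assume A: "\<And>i. i \<in> {..<Suc n} \<Longrightarrow> A i \<in> sets photon_measure"
    have skip: "skip j i < Suc n" if "i < n" for i
      using that by (simp add: skip_def)
    have 1: "(\<lambda>(q, K). insert_at j q K) -` Pi\<^sub>E {..<Suc n} A \<inter> space (photon_measure \<Otimes>\<^sub>M photons_measure n) =
        A j \<times> Pi\<^sub>E {..<n} (\<lambda>i. A (skip j i))"
    proof -
      have "insert_at j q K \<in> Pi\<^sub>E {..<Suc n} A \<longleftrightarrow> q \<in> A j \<and> K \<in> Pi\<^sub>E {..<n} (\<lambda>i. A (skip j i))"
        if "K \<in> extensional {..<n}" for q K
      proof -
        have "insert_at j q K \<in> extensional {..<Suc n}"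
          using that assms by (auto simp: extensional_def insert_at_def)
        then have "insert_at j q K \<in> Pi\<^sub>E {..<Suc n} A \<longleftrightarrow> (\<forall>i\<in>{..<Suc n}. insert_at j q K i \<in> A i)"
          by (auto simp: PiE_def)
        also have "\<dots> \<longleftrightarrow> q \<in> A j \<and> K \<in> Pi\<^sub>E {..<n} (\<lambda>i. A (skip j i))"
          unfolding lessThan_Suc_skip[OF assms] using that by (auto simp: PiE_def)
        finally show ?thesis .
      qed
      moreover have "K \<in> extensional {..<n}" if "K \<in> Pi\<^sub>E {..<n} (\<lambda>i. A (skip j i))" for K
        using that by (simp add: PiE_def)
      ultimately show ?thesis
        by (simp only: set_eq_iff split_paired_All vimage_eq Int_iff mem_Times_iff fst_conv snd_conv
            case_prod_conv space_pair_measure space_photons_measure space_photon_measure UNIV_I) blast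
    qed
    have 2: "Pi\<^sub>E {..<Suc n} A \<in> sets (photons_measure (Suc n))"
      unfolding photons_measure_def by (rule sets_PiM_I_finite) (use A in auto)
    have "emeasure ?D (Pi\<^sub>E {..<Suc n} A) =
        emeasure (photon_measure \<Otimes>\<^sub>M photons_measure n) (A j \<times> Pi\<^sub>E {..<n} (\<lambda>i. A (skip j i)))"
      by (simp only: emeasure_distr[OF measurable_insert_at[OF assms] 2] 1)
    also have "\<dots> = emeasure photon_measure (A j) * emeasure (photons_measure n) (Pi\<^sub>E {..<n} (\<lambda>i. A (skip j i)))"
      by (rule N.emeasure_pair_measure_Times) (use A assms skip in \<open>auto simp: photons_measure_def intro!: sets_PiM_I_finite\<close>)
    also have "emeasure (photons_measure n) (Pi\<^sub>E {..<n} (\<lambda>i. A (skip j i))) = (\<Prod>i<n. emeasure photon_measure (A (skip j i)))"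
      unfolding photons_measure_def by (rule photons.emeasure_PiM) (use A skip in auto)
    finally show "emeasure ?D (Pi\<^sub>E {..<Suc n} A) = (\<Prod>i<Suc n. emeasure photon_measure (A i))"
      by (simp only: prod_lessThan_Suc_skip[OF assms])
  qed (simp_all add: photons_measure_def)
  then show ?thesis
    by (simp add: photons_measure_def)
qed

section \<open>A class of Fock vectors stable under the Segal field\<close>

lemma borel_measurable_cnj [measurable]:
  "f \<in> borel_measurable M \<Longrightarrow> (\<lambda>x. cnj (f x)) \<in> borel_measurable M"
  by (rule measurable_compose[OF _ borel_measurable_continuous_onI[OF continuous_on_cnj[OF continuous_on_id]]])

lemma sqrt_Suc_le: "m \<le> N \<Longrightarrow> sqrt (real (Suc m)) \<le> real (Suc N)"
  by (intro real_le_lsqrt order_trans[OF _ self_le_power]) auto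

locale photon_weight =
  fixes g :: "photon \<Rightarrow> real" and \<epsilon> :: real
  assumes g_measurable [measurable]: "g \<in> borel_measurable photon_measure"
    and g_nonneg: "\<And>q. 0 \<le> g q"
    and g_square_integrable: "integrable photon_measure (\<lambda>q. (g q)\<^sup>2)"
    and eps: "0 < \<epsilon>"
    and g_infrared: "\<And>q. norm (fst q) < \<epsilon> \<Longrightarrow> g q = 0"
begin

definition form_factor :: "(photon \<Rightarrow> complex) \<Rightarrow> bool" where
  "form_factor f \<longleftrightarrow> f \<in> borel_measurable photon_measure \<and> (\<forall>q. cmod (f q) \<le> g q) \<and>
     (\<forall>k. (\<Sum>i\<in>UNIV. of_real (k $ i) * f (k, i)) = 0)"

text \<open>The same weight bounds vectors and form factors: creation then adds one factor
  \<open>g\<close>, and annihilation integrates \<open>g\<close> squared, so both operators change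
  only the constant and the number of sectors.\<close>

definition dominated :: "real \<Rightarrow> nat \<Rightarrow> fock \<Rightarrow> bool" where
  "dominated C N u \<longleftrightarrow> (\<forall>n K. cmod (u n K) \<le> (if n \<le> N then C * (\<Prod>j<n. g (K j)) else 0))"

text \<open>
  The conditions hold pointwise rather than almost everywhere, so that the operators can be applied
  and compared without null sets. The second one is permutation symmetry together with independence
  of \<open>K i\<close> for \<open>i \<ge> n\<close>.
\<close>
definition regular :: "fock set" where
  "regular = {u. (\<forall>n. u n \<in> borel_measurable (photons_measure n)) \<and>
     (\<forall>n K K'. entries n K = entries n K' \<longrightarrow> u n K = u n K') \<and>
     (\<forall>n K k. (\<Sum>i\<in>UNIV. of_real (k $ i) * u (Suc n) (case_nat (k, i) K)) = 0) \<and>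
     (\<exists>C N. dominated C N u)}"

lemma regularI:
  assumes "\<And>n. u n \<in> borel_measurable (photons_measure n)"
    and "\<And>n K K'. entries n K = entries n K' \<Longrightarrow> u n K = u n K'"
    and "\<And>n K k. (\<Sum>i\<in>UNIV. of_real (k $ i) * u (Suc n) (case_nat (k, i) K)) = 0"
    and "dominated C N u"
  shows "u \<in> regular"
  using assms unfolding regular_def by blast

lemma
  assumes "u \<in> regular"
  shows regular_measurable: "u n \<in> borel_measurable (photons_measure n)"
    and regular_cong: "entries n K = entries n K' \<Longrightarrow> u n K = u n K'"
    and regular_transverse: "(\<Sum>i\<in>UNIV. of_real (k $ i) * u (Suc n) (case_nat (k, i) K)) = 0"
    and regular_dominated: "\<exists>C N. dominated C N u"
  using assms unfolding regular_def by blast+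

lemma form_factor_measurable [measurable_dest]: "form_factor f \<Longrightarrow> f \<in> borel_measurable photon_measure"
  and form_factor_le: "form_factor f \<Longrightarrow> cmod (f q) \<le> g q"
  and form_factor_transverse: "form_factor f \<Longrightarrow> (\<Sum>i\<in>UNIV. of_real (k $ i) * f (k, i)) = 0"
  unfolding form_factor_def by blast+

abbreviation weight :: "nat \<Rightarrow> (nat \<Rightarrow> photon) \<Rightarrow> real" where
  "weight n K \<equiv> (\<Prod>j<n. g (K j))"

lemma weight_nonneg: "0 \<le> weight n K"
  by (intro prod_nonneg g_nonneg ballI)

lemma dominatedD: "dominated C N u \<Longrightarrow> cmod (u n K) \<le> (if n \<le> N then C * weight n K else 0)"
  unfolding dominated_def by blast

text \<open>On the sector without photons the weight is an empty product, so \<open>C\<close> itself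
  bounds a modulus.\<close>

lemma dominated_const_nonneg:
  assumes "dominated C N u"
  shows "0 \<le> C"
proof -
  have "cmod (u 0 undefined) \<le> C"
    using dominatedD[OF assms, of 0 undefined] by simp
  then show ?thesis
    using norm_ge_zero order_trans by blast
qed

lemma dominatedD':
  assumes "dominated C N u"
  shows "cmod (u n K) \<le> C * weight n K"
  using dominatedD[OF assms, of n K] dominated_const_nonneg[OF assms] weight_nonneg[of K n]
  by (auto split: if_splits intro: order_trans[OF _ mult_nonneg_nonneg])

lemma dominated_mono:
  assumes "dominated C N u" "C \<le> C'" "N \<le> N'"
  shows "dominated C' N' u"
  unfolding dominated_def
proof (intro allI)
  fix n K
  have "C * weight n K \<le> C' * weight n K"
    by (intro mult_right_mono assms weight_nonneg)
  moreover have "0 \<le> C' * weight n K"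
    using dominated_const_nonneg[OF assms(1)] assms(2) weight_nonneg[of K n] by simp
  ultimately show "cmod (u n K) \<le> (if n \<le> N' then C' * weight n K else 0)"
    using dominatedD[OF assms(1), of n K] assms(3) by (auto split: if_splits)
qed

lemma dominated_add:
  assumes "dominated C N u" "dominated D M v"
  shows "dominated (C + D) (max N M) (\<lambda>n K. u n K + v n K)"
  unfolding dominated_def
proof (intro allI)
  fix n K
  have "cmod (u n K + v n K) \<le> cmod (u n K) + cmod (v n K)"
    by (rule norm_triangle_ineq)
  moreover have "0 \<le> C * weight n K" "0 \<le> D * weight n K"
    using assms[THEN dominated_const_nonneg] weight_nonneg[of K n] by auto
  ultimately show "cmod (u n K + v n K) \<le> (if n \<le> max N M then (C + D) * weight n K else 0)"
    using assms[THEN dominatedD, of n K] by (auto simp: distrib_right split: if_splits)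
qed

lemma dominated_scale:
  assumes "dominated C N u"
  shows "dominated (cmod c * C) N (\<lambda>n K. c * u n K)"
  unfolding dominated_def
proof (intro allI)
  fix n K
  show "cmod (c * u n K) \<le> (if n \<le> N then cmod c * C * weight n K else 0)"
    using mult_left_mono[OF dominatedD[OF assms, of n K], of "cmod c"]
    by (auto simp: norm_mult mult.assoc split: if_splits)
qed

lemma dominated_zero: "dominated 0 0 (\<lambda>n K. 0)"
  by (simp add: dominated_def)

lemma regular_zero: "(\<lambda>n K. 0) \<in> regular"
  by (rule regularI[OF _ _ _ dominated_zero]) auto

lemma regular_add:
  assumes "u \<in> regular" "v \<in> regular"
  shows "(\<lambda>n K. u n K + v n K) \<in> regular"
proof -
  obtain C N D M where "dominated C N u" "dominated D M v"
    using assms[THEN regular_dominated] by blast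
  note [measurable] = assms[THEN regular_measurable]
  show ?thesis
    by (rule regularI[OF _ _ _ dominated_add])
      (fact | simp add: assms[THEN regular_transverse] distrib_left sum.distrib |
        metis assms regular_cong)+
qed

lemma regular_scale:
  assumes "u \<in> regular"
  shows "(\<lambda>n K. c * u n K) \<in> regular"
proof -
  obtain C N where CN: "dominated C N u"
    using assms[THEN regular_dominated] by blast
  note [measurable] = assms[THEN regular_measurable]
  have *: "(\<Sum>i\<in>UNIV. of_real (k $ i) * (c * u (Suc n) (case_nat (k, i) K))) = 0" for k n K
    using regular_transverse[OF assms, of k n K]
    by (simp add: mult.left_commute[of _ c] sum_distrib_left[symmetric])
  show ?thesis
  proof (rule regularI[OF _ _ _ dominated_scale[OF CN]])
    show "c * u n K = c * u n K'" if "entries n K = entries n K'" for n K K'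
      by (rule arg_cong[OF regular_cong[OF assms that]])
  qed (simp_all add: *)
qed

lemma regular_sum:
  "(\<And>i. i \<in> I \<Longrightarrow> u i \<in> regular) \<Longrightarrow> (\<lambda>n K. \<Sum>i\<in>I. u i n K) \<in> regular"
  by (induction I rule: infinite_finite_induct) (simp_all add: regular_zero regular_add)

lemma vacuum_regular: "vacuum \<in> regular"
proof (rule regularI)
  show "dominated 1 0 vacuum"
    by (simp add: dominated_def vacuum_def)
qed (simp_all add: vacuum_def[abs_def])

lemma nn_integral_weight:
  "(\<integral>\<^sup>+K. ennreal ((weight n K)\<^sup>2) \<partial>photons_measure n) = ennreal ((\<integral>q. (g q)\<^sup>2 \<partial>photon_measure) ^ n)"
proof -
  have "(\<integral>\<^sup>+K. ennreal ((weight n K)\<^sup>2) \<partial>photons_measure n) =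
      (\<integral>\<^sup>+K. (\<Prod>j<n. ennreal ((g (K j))\<^sup>2)) \<partial>photons_measure n)"
    by (simp add: prod_ennreal prod_power_distrib)
  also have "\<dots> = (\<Prod>j<n. \<integral>\<^sup>+q. ennreal ((g q)\<^sup>2) \<partial>photon_measure)"
    unfolding photons_measure_def
    by (rule photons.product_nn_integral_prod) auto
  also have "\<dots> = ennreal ((\<integral>q. (g q)\<^sup>2 \<partial>photon_measure) ^ n)"
    by (simp add: nn_integral_eq_integral[OF g_square_integrable] ennreal_power)
  finally show ?thesis .
qed

lemma fock_norm2_le:
  assumes "dominated C N u"
  shows "fock_norm2 u \<le> ennreal (C\<^sup>2 * (\<Sum>n\<le>N. (\<integral>q. (g q)\<^sup>2 \<partial>photon_measure) ^ n))"
proof -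
  let ?G = "\<integral>q. (g q)\<^sup>2 \<partial>photon_measure"
  have C: "0 \<le> C" by (rule dominated_const_nonneg[OF assms])
  have *: "(\<integral>\<^sup>+K. ennreal ((cmod (u n K))\<^sup>2) \<partial>photons_measure n) \<le>
      (if n \<le> N then ennreal (C\<^sup>2 * ?G ^ n) else 0)" for n
  proof (cases "n \<le> N")
    case True
    have "(\<integral>\<^sup>+K. ennreal ((cmod (u n K))\<^sup>2) \<partial>photons_measure n) \<le>
        (\<integral>\<^sup>+K. ennreal (C\<^sup>2) * ennreal ((weight n K)\<^sup>2) \<partial>photons_measure n)"
      using power_mono[OF dominatedD'[OF assms], of _ _ 2]
      by (intro nn_integral_mono) (simp add: ennreal_mult'[symmetric] power_mult_distrib)
    also have "\<dots> = ennreal (C\<^sup>2) * ennreal (?G ^ n)"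
      by (subst nn_integral_cmult) (simp_all add: nn_integral_weight)
    finally show ?thesis
      using True by (simp add: ennreal_mult')
  next
    case False
    then have "u n K = 0" for K
      using dominatedD[OF assms, of n K] by simp
    then show ?thesis by simp
  qed
  have "fock_norm2 u \<le> (\<Sum>n. if n \<le> N then ennreal (C\<^sup>2 * ?G ^ n) else 0)"
    unfolding fock_norm2_def by (intro suminf_le * summableI)
  also have "\<dots> = (\<Sum>n\<le>N. ennreal (C\<^sup>2 * ?G ^ n))"
    by (subst suminf_finite[of "{..N}"]) auto
  also have "\<dots> = ennreal (C\<^sup>2 * (\<Sum>n\<le>N. ?G ^ n))"
    by (simp add: sum_distrib_left)
  finally show ?thesis .
qed

lemma regular_fock_space:
  assumes "u \<in> regular"
  shows "u \<in> fock_space"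
proof -
  obtain C N where "dominated C N u"
    using assms[THEN regular_dominated] by blast
  then have "fock_norm2 u < \<infinity>"
    using fock_norm2_le by (metis ennreal_less_top infinity_ennreal_def order_le_less_trans)
  moreover have "u n (K \<circ> \<pi>) = u n K" if "\<pi> permutes {..<n}" for n K \<pi>
    by (rule regular_cong[OF assms entries_permute[OF that]])
  moreover have "(\<Sum>i\<in>UNIV. of_real (k $ i) * u n (K(j := (k, i)))) = 0" if j: "j < n" for n K k j
  proof -
    obtain m where n: "n = Suc m" "j \<le> m"
      using j by (cases n) auto
    \<comment> \<open>The class asks for transversality in variable 0 only; symmetry transports it
      to variable \<open>j\<close>.\<close>
    have "u n (K(j := q)) = u n (case_nat q (\<lambda>i. K (skip j i)))" for q
      unfolding n(1)
      by (rule regular_cong[OF assms]) (use n(2) in \<open>simp add: entries_skip entries_case_nat skip_neq[THEN not_sym]\<close>)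
    then show ?thesis
      unfolding n(1) by (simp add: regular_transverse[OF assms])
  qed
  ultimately show ?thesis
    unfolding fock_space_def transverse_def by (simp add: regular_measurable[OF assms])
qed

section \<open>Creation and annihilation on the class\<close>

lemma creation_0: "creation f u 0 K = 0"
  by (simp add: creation_def)

lemma creation_Suc:
  "creation f u (Suc n) K = of_real (1 / sqrt (Suc n)) * (\<Sum>j<Suc n. f (K j) * u n (\<lambda>i. K (skip j i)))"
  by (simp add: creation_def skip_def)

text \<open>Each of the \<open>Suc m\<close> summands is bounded by the full weight, so the
  normalisation leaves a factor \<open>sqrt (Suc m)\<close>. The bound on the number of photons
  turns it into the constant \<open>Suc N\<close>.\<close>

lemma dominated_creation:
  assumes f: "form_factor f" and u: "dominated C N u"
  shows "dominated (real (Suc N) * C) (Suc N) (creation f u)"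
  unfolding dominated_def
proof (intro allI)
  fix n K
  have C: "0 \<le> C" by (rule dominated_const_nonneg[OF u])
  show "cmod (creation f u n K) \<le> (if n \<le> Suc N then real (Suc N) * C * weight n K else 0)"
  proof (cases n)
    case 0
    then show ?thesis using C by (simp add: creation_0)
  next
    case (Suc m)
    show ?thesis
    proof (cases "m \<le> N")
      case True
      have le: "cmod (f (K j) * u m (\<lambda>i. K (skip j i))) \<le> C * weight (Suc m) K" if "j < Suc m" for j
      proof -
        have "cmod (f (K j) * u m (\<lambda>i. K (skip j i))) \<le> g (K j) * (C * weight m (\<lambda>i. K (skip j i)))"
          unfolding norm_mult
          by (intro mult_mono form_factor_le[OF f] dominatedD'[OF u] g_nonneg norm_ge_zero)
        also have "\<dots> = C * weight (Suc m) K"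
          using that by (subst prod_lessThan_Suc_skip[of j]) auto
        finally show ?thesis .
      qed
      have "cmod (creation f u n K) \<le> 1 / sqrt (Suc m) * (\<Sum>j<Suc m. C * weight (Suc m) K)"
        unfolding Suc creation_Suc norm_mult
        by (intro mult_mono sum_norm_le le) (auto simp: norm_divide simp del: prod.lessThan_Suc intro!: sum_nonneg mult_nonneg_nonneg C weight_nonneg)
      also have "\<dots> = sqrt (Suc m) * C * weight (Suc m) K"
        using real_div_sqrt[of "real (Suc m)"] by (simp del: prod.lessThan_Suc add: mult.assoc[symmetric])
      also have "\<dots> \<le> real (Suc N) * C * weight (Suc m) K"
        using True by (intro mult_right_mono C weight_nonneg sqrt_Suc_le)
      finally show ?thesis
        using True Suc by simp
    next
      case False
      then have "u m K = 0" for K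
        using dominatedD[OF u, of m K] by simp
      then show ?thesis
        using False by (simp add: Suc creation_Suc)
    qed
  qed
qed

lemma regular_creation:
  assumes f: "form_factor f" and u: "u \<in> regular"
  shows "creation f u \<in> regular"
proof -
  obtain C N where CN: "dominated C N u"
    using u[THEN regular_dominated] by blast
  show ?thesis
  proof (rule regularI[OF _ _ _ dominated_creation[OF f CN]])
    fix n
    note [measurable] = form_factor_measurable[OF f] regular_measurable[OF u]
    show "creation f u n \<in> borel_measurable (photons_measure n)"
    proof (cases n)
      case 0
      then show ?thesis by (simp add: creation_0[abs_def])
    next
      case (Suc m)
      have [measurable]: "(\<lambda>K. u m (\<lambda>i. K (skip j i))) \<in> borel_measurable (photons_measure (Suc m))"
        if "j < Suc m" for j
        using that by (intro measurable_compose[OF measurable_skip]) auto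
      show ?thesis
        unfolding Suc creation_Suc[abs_def]
        by (intro borel_measurable_times borel_measurable_sum borel_measurable_const)
          (auto intro!: borel_measurable_times measurable_compose[OF measurable_component form_factor_measurable[OF f]])
    qed
  next
    fix n and K K' :: "nat \<Rightarrow> photon" assume eq: "entries n K = entries n K'"
    show "creation f u n K = creation f u n K'"
    proof (cases n)
      case 0
      then show ?thesis by (simp add: creation_0)
    next
      case (Suc m)
      \<comment> \<open>\<open>U\<close> is \<open>u m\<close> as a function of the multiset of
        photons; the choice of representative is immaterial by \<open>regular_cong\<close>. Each
        summand then depends only on \<open>K j\<close> and on the whole multiset, so the sum over
        positions is a sum over \<open>entries\<close>.\<close>
      define U where "U M = u m (SOME K. entries m K = M)" for M
      have U: "u m K = U (entries m K)" for K
        unfolding U_def by (rule regular_cong[OF u]) (metis (mono_tags) someI)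
      have "(\<Sum>j<Suc m. f (K j) * u m (\<lambda>i. K (skip j i))) =
          (\<Sum>j<Suc m. f (K j) * U (entries (Suc m) K - {#K j#}))" for K
        by (intro sum.cong refl) (auto simp: U entries_skip less_Suc_eq_le)
      then show ?thesis
        unfolding Suc creation_Suc
        using sum_entries[where f = "\<lambda>q. f q * U (entries (Suc m) K - {#q#})" and n = "Suc m"]
          eq Suc by simp
    qed
  next
    fix n :: nat and K :: "nat \<Rightarrow> photon" and k
    have "(\<Sum>i\<in>UNIV. of_real (k $ i) * (\<Sum>j<Suc n. f (case_nat (k, i) K j) * u n (\<lambda>l. case_nat (k, i) K (skip j l)))) =
       (\<Sum>j<Suc n. \<Sum>i\<in>UNIV. of_real (k $ i) * (f (case_nat (k, i) K j) * u n (\<lambda>l. case_nat (k, i) K (skip j l))))"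
      unfolding sum_distrib_left by (rule sum.swap)
    also have "\<dots> = (\<Sum>j<Suc n. 0)"
    proof (intro sum.cong refl)
      fix j assume j: "j \<in> {..<Suc n}"
      show "(\<Sum>i\<in>UNIV. of_real (k $ i) * (f (case_nat (k, i) K j) * u n (\<lambda>l. case_nat (k, i) K (skip j l)))) = 0"
      \<comment> \<open>The new photon sits in variable 0: for \<open>j = 0\<close> it is an
        argument of \<open>f\<close>, otherwise the first argument of \<open>u\<close>, and the
        transversality of that factor applies.\<close>
      proof (cases j)
        case 0
        then show ?thesis
          using form_factor_transverse[OF f, of k]
          by (simp add: skip_def mult.assoc[symmetric] sum_distrib_right[symmetric])
      next
        case (Suc l)
        then obtain m where m: "n = Suc m" using j by (cases n) auto
        show ?thesis
          unfolding Suc m skip_Suc_case_nat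
          using regular_transverse[OF u, of k m "\<lambda>i. K (skip l i)"]
          by (simp add: mult.left_commute[of _ "f _"] sum_distrib_left[symmetric])
      qed
    qed
    finally show "(\<Sum>i\<in>UNIV. of_real (k $ i) * creation f u (Suc n) (case_nat (k, i) K)) = 0"
      unfolding creation_Suc
      by (simp only: mult.left_commute[of _ "complex_of_real (1 / sqrt (real (Suc n)))"]
          sum_distrib_left[symmetric] sum.neutral_const mult_zero_right)
  qed
qed

text \<open>An arbitrary \<open>K\<close> need not be a point of the product space, so it is first
  restricted; \<open>u\<close> sees only its first entries.\<close>

lemma measurable_slice:
  assumes "u \<in> regular"
  shows "(\<lambda>q. u (Suc n) (case_nat q K)) \<in> borel_measurable photon_measure"
proof -
  let ?K = "restrict K {..<n}"
  have "entries n K = entries n ?K"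
    by (auto simp: entries_def intro!: image_mset_cong)
  then have "u (Suc n) (case_nat q K) = u (Suc n) (insert_at 0 q ?K)" for q
    by (intro regular_cong[OF assms]) (simp add: entries_case_nat entries_insert_at)
  moreover have "(\<lambda>q. insert_at 0 q ?K) \<in> photon_measure \<rightarrow>\<^sub>M photons_measure (Suc n)"
    using measurable_compose[OF measurable_Pair2'[of ?K "photons_measure n" photon_measure] measurable_insert_at[of 0 n]]
    by (simp add: space_photons_measure)
  ultimately show ?thesis
    using measurable_compose[OF _ regular_measurable[OF assms]] by simp
qed

lemma annihilation_integrand_le:
  assumes f: "form_factor f" and u: "dominated C N u"
  shows "cmod (cnj (f q) * u (Suc n) (case_nat q K)) \<le> C * weight n K * (g q)\<^sup>2"
proof -
  have "cmod (cnj (f q) * u (Suc n) (case_nat q K)) \<le> g q * (C * weight (Suc n) (case_nat q K))"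
    unfolding norm_mult complex_mod_cnj
    by (intro mult_mono form_factor_le[OF f] dominatedD'[OF u] g_nonneg norm_ge_zero)
  also have "\<dots> = C * weight n K * (g q)\<^sup>2"
    by (simp only: prod.lessThan_Suc_shift) (simp add: power2_eq_square)
  finally show ?thesis .
qed

lemma annihilation_integrable:
  assumes f: "form_factor f" and u: "u \<in> regular"
  shows "integrable photon_measure (\<lambda>q. cnj (f q) * u (Suc n) (case_nat q K))"
proof -
  obtain C N where CN: "dominated C N u"
    using u[THEN regular_dominated] by blast
  note [measurable] = form_factor_measurable[OF f] measurable_slice[OF u]
  show ?thesis
  proof (rule Bochner_Integration.integrable_bound)
    show "integrable photon_measure (\<lambda>q. C * weight n K * (g q)\<^sup>2)"
      by (intro integrable_mult_right g_square_integrable)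
    show "AE q in photon_measure. norm (cnj (f q) * u (Suc n) (case_nat q K)) \<le> norm (C * weight n K * (g q)\<^sup>2)"
      by (intro AE_I2) (metis annihilation_integrand_le[OF f CN] real_norm_def abs_ge_self order_trans)
  qed measurable
qed

lemma dominated_annihilation:
  assumes f: "form_factor f" and u: "dominated C N u"
  shows "dominated (real (Suc N) * (C * (\<integral>q. (g q)\<^sup>2 \<partial>photon_measure))) N (annihilation f u)"
  unfolding dominated_def
proof (intro allI)
  fix n K
  let ?G = "\<integral>q. (g q)\<^sup>2 \<partial>photon_measure"
  have C: "0 \<le> C" by (rule dominated_const_nonneg[OF u])
  have G: "0 \<le> ?G" by (intro integral_nonneg_AE) simp
  show "cmod (annihilation f u n K) \<le> (if n \<le> N then real (Suc N) * (C * ?G) * weight n K else 0)"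
  proof (cases "Suc n \<le> N")
    case True
    have "cmod (\<integral>q. cnj (f q) * u (Suc n) (case_nat q K) \<partial>photon_measure)
        \<le> (\<integral>q. cmod (cnj (f q) * u (Suc n) (case_nat q K)) \<partial>photon_measure)"
      by (rule integral_norm_bound)
    also have "\<dots> \<le> (\<integral>q. C * weight n K * (g q)\<^sup>2 \<partial>photon_measure)"
      using C weight_nonneg[of K n]
      by (intro integral_mono' annihilation_integrand_le[OF f u] integrable_mult_right g_square_integrable) simp
    also have "\<dots> = C * ?G * weight n K"
      by simp
    finally have 1: "cmod (\<integral>q. cnj (f q) * u (Suc n) (case_nat q K) \<partial>photon_measure) \<le> C * ?G * weight n K" .
    have 2: "sqrt (real n + 1) \<le> real (Suc N)"
      using sqrt_Suc_le[of n N] True by (simp add: add.commute)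
    have "cmod (annihilation f u n K) \<le> real (Suc N) * (C * ?G * weight n K)"
      unfolding annihilation_def norm_mult
      by (rule mult_mono) (use 1 2 in auto)
    then show ?thesis
      using True by (simp add: mult.assoc)
  next
    case False
    then have "u (Suc n) K = 0" for K
      using dominatedD[OF u, of "Suc n" K] by simp
    then show ?thesis
      using C G weight_nonneg[of K n] by (simp add: annihilation_def)
  qed
qed

lemma regular_annihilation:
  assumes f: "form_factor f" and u: "u \<in> regular"
  shows "annihilation f u \<in> regular"
proof -
  obtain C N where CN: "dominated C N u"
    using u[THEN regular_dominated] by blast
  show ?thesis
  proof (rule regularI[OF _ _ _ dominated_annihilation[OF f CN]])
    fix n
    note [measurable] = form_factor_measurable[OF f] regular_measurable[OF u]
    have "(\<lambda>(K, q). insert_at 0 q K) \<in> photons_measure n \<Otimes>\<^sub>M photon_measure \<rightarrow>\<^sub>M photons_measure (Suc n)"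
      using measurable_compose[OF measurable_pair_swap' measurable_insert_at[of 0 n]] by (simp add: split_beta')
    then have [measurable]: "(\<lambda>p. u (Suc n) (case_nat (snd p) (fst p))) \<in> borel_measurable (photons_measure n \<Otimes>\<^sub>M photon_measure)"
      using measurable_compose[OF _ regular_measurable[OF u]] by (simp add: split_beta' case_nat_eq_insert_at)
    have "(\<lambda>K. \<integral>q. cnj (f q) * u (Suc n) (case_nat q K) \<partial>photon_measure) \<in> borel_measurable (photons_measure n)"
      by (rule photon.borel_measurable_lebesgue_integral) (subst split_beta', measurable)
    then show "annihilation f u n \<in> borel_measurable (photons_measure n)"
      unfolding annihilation_def[abs_def] by simp
  next
    fix n and K K' :: "nat \<Rightarrow> photon" assume "entries n K = entries n K'"
    then have "u (Suc n) (case_nat q K) = u (Suc n) (case_nat q K')" for q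
      by (intro regular_cong[OF u]) (simp add: entries_case_nat)
    then show "annihilation f u n K = annihilation f u n K'"
      by (simp add: annihilation_def)
  next
    fix n :: nat and K :: "nat \<Rightarrow> photon" and k
    let ?u = "\<lambda>q i. u (Suc (Suc n)) (case_nat q (case_nat (k, i) K))"
    have "(\<Sum>i\<in>UNIV. of_real (k $ i) * (\<integral>q. cnj (f q) * ?u q i \<partial>photon_measure)) =
        (\<integral>q. (\<Sum>i\<in>UNIV. of_real (k $ i) * (cnj (f q) * ?u q i)) \<partial>photon_measure)"
      by (subst Bochner_Integration.integral_sum) (simp_all add: annihilation_integrable[OF f u])
    also have "\<dots> = (\<integral>q. 0 \<partial>photon_measure)"
    proof (intro Bochner_Integration.integral_cong refl)
      fix q
      \<comment> \<open>Symmetry brings the photon \<open>(k, i)\<close> back to variable 0 in place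
        of the integrated one.\<close>
      have "?u q i = u (Suc (Suc n)) (case_nat (k, i) (case_nat q K))" for i
        by (rule regular_cong[OF u]) (simp add: entries_case_nat add_mset_commute)
      then show "(\<Sum>i\<in>UNIV. of_real (k $ i) * (cnj (f q) * ?u q i)) = 0"
        using regular_transverse[OF u, of k "Suc n" "case_nat q K"]
        by (simp add: mult.left_commute[of _ "cnj _"] sum_distrib_left[symmetric])
    qed
    finally show "(\<Sum>i\<in>UNIV. of_real (k $ i) * annihilation f u (Suc n) (case_nat (k, i) K)) = 0"
      unfolding annihilation_def
      by (simp add: mult.left_commute[of _ "of_real (sqrt _)"] sum_distrib_left[symmetric])
  qed
qed

lemma regular_segal: "form_factor f \<Longrightarrow> u \<in> regular \<Longrightarrow> segal f u \<in> regular"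
  unfolding segal_def[abs_def] by (intro regular_scale regular_add regular_creation regular_annihilation)

lemma segal_add:
  assumes "form_factor f" "u \<in> regular" "v \<in> regular"
  shows "segal f (\<lambda>n K. u n K + v n K) n K = segal f u n K + segal f v n K"
  by (simp add: segal_def annihilation_def creation_def annihilation_integrable assms
      distrib_left sum.distrib algebra_simps)

lemma segal_scale: "segal f (\<lambda>n K. c * u n K) n K = c * segal f u n K"
proof -
  have "(\<integral>q. cnj (f q) * (c * u (Suc n) (case_nat q K)) \<partial>photon_measure) =
      c * (\<integral>q. cnj (f q) * u (Suc n) (case_nat q K) \<partial>photon_measure)"
    by (subst mult.left_commute) (rule integral_mult_right_zero)
  then show ?thesis
    by (simp add: segal_def annihilation_def creation_def mult.left_commute[of _ c]
        sum_distrib_left[symmetric]) (simp add: algebra_simps)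
qed

end

section \<open>The inner product and the adjointness of creation and annihilation\<close>

definition photon_energy :: "nat \<Rightarrow> (nat \<Rightarrow> photon) \<Rightarrow> real" where
  "photon_energy n K = (\<Sum>j<n. norm (fst (K j)))"

lemma photon_energy_0 [simp]: "photon_energy 0 K = 0"
  by (simp add: photon_energy_def)

lemma photon_energy_nonneg: "0 \<le> photon_energy n K"
  by (simp add: photon_energy_def sum_nonneg)

lemma photon_energy_cong: "entries n K = entries n K' \<Longrightarrow> photon_energy n K = photon_energy n K'"
  unfolding photon_energy_def sum_entries[of "\<lambda>q. norm (fst q)"] by simp

lemma photon_energy_case_nat: "photon_energy (Suc n) (case_nat q K) = norm (fst q) + photon_energy n K"
  unfolding photon_energy_def sum.lessThan_Suc_shift by simp

lemma photon_energy_measurable [measurable]: "photon_energy n \<in> borel_measurable (photons_measure n)"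
proof -
  have "(\<lambda>q. norm (fst q)) \<in> borel_measurable photon_measure"
    unfolding photon_measure_def by measurable
  then show ?thesis
    unfolding photon_energy_def[abs_def]
    by (intro borel_measurable_sum) (auto intro: measurable_compose[OF measurable_component])
qed

lemma dGamma_mult_abs: "dGamma mult_abs u n K = of_real (photon_energy n K) * u n K"
  by (simp add: dGamma_def mult_abs_def split_beta photon_energy_def sum_distrib_right)

context photon_weight
begin

text \<open>This replaces the spectral gap: where \<open>u\<close> does not vanish, neither does the
  factor \<open>g (K 0)\<close>, and the momentum of that single photon already has norm at least
  \<open>\<epsilon>\<close>.\<close>

lemma photon_energy_ge:
  assumes "u \<in> regular" "u n K \<noteq> 0" "n \<noteq> 0"
  shows "\<epsilon> \<le> photon_energy n K"
proof -
  obtain C N where "dominated C N u"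
    using assms(1)[THEN regular_dominated] by blast
  from dominatedD'[OF this, of n K] have "weight n K \<noteq> 0"
    using assms(2) by (metis mult_zero_right norm_le_zero_iff)
  then have "g (K 0) \<noteq> 0"
    using assms(3) by simp
  then have "\<epsilon> \<le> norm (fst (K 0))"
    using g_infrared by (meson not_le)
  also have "\<dots> \<le> photon_energy n K"
    unfolding photon_energy_def by (rule member_le_sum) (use assms(3) in auto)
  finally show ?thesis .
qed

text \<open>On the support of \<open>u\<close> the energy is 0 or at least
  \<open>\<epsilon>\<close>, so \<open>\<rho>\<close> may be unbounded in between, as an inverse
  is.\<close>

lemma regular_multiplier:
  fixes \<rho> :: "real \<Rightarrow> complex"
  assumes [measurable]: "\<rho> \<in> borel_measurable borel"
    and \<rho>: "cmod (\<rho> 0) \<le> c" "\<And>t. \<epsilon> \<le> t \<Longrightarrow> cmod (\<rho> t) \<le> c"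
    and u: "u \<in> regular"
  shows "(\<lambda>n K. \<rho> (photon_energy n K) * u n K) \<in> regular"
proof -
  obtain C N where CN: "dominated C N u"
    using u[THEN regular_dominated] by blast
  have le: "cmod (\<rho> (photon_energy n K) * u n K) \<le> c * cmod (u n K)" for n K
  proof (cases "u n K = 0")
    case False
    then have "cmod (\<rho> (photon_energy n K)) \<le> c"
      using photon_energy_ge[OF u False] \<rho> by (cases n) auto
    then show ?thesis
      by (simp add: norm_mult mult_right_mono)
  qed simp
  have "0 \<le> c"
    using \<rho>(1) norm_ge_zero order_trans by blast
  then have "c * cmod (u n K) \<le> (if n \<le> N then c * C * weight n K else 0)" for n K
    using mult_left_mono[OF dominatedD[OF CN, of n K], of c] by (auto simp: mult.assoc split: if_splits)
  with le have dom: "dominated (c * C) N (\<lambda>n K. \<rho> (photon_energy n K) * u n K)"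
    unfolding dominated_def by (blast intro: order_trans)
  show ?thesis
  proof (rule regularI[OF _ _ _ dom])
    note [measurable] = regular_measurable[OF u]
    show "(\<lambda>K. \<rho> (photon_energy n K) * u n K) \<in> borel_measurable (photons_measure n)" for n
      by measurable
    show "\<rho> (photon_energy n K) * u n K = \<rho> (photon_energy n K') * u n K'"
      if "entries n K = entries n K'" for n K K'
      by (simp only: photon_energy_cong[OF that] regular_cong[OF u that])
    show "(\<Sum>i\<in>UNIV. of_real (k $ i) * (\<rho> (photon_energy (Suc n) (case_nat (k, i) K)) *
        u (Suc n) (case_nat (k, i) K))) = 0" for n K k
      using regular_transverse[OF u, of k n K]
      by (simp add: photon_energy_case_nat mult.left_commute[of _ "\<rho> _"] sum_distrib_left[symmetric])
  qed
qed

definition fock_inner :: "fock \<Rightarrow> fock \<Rightarrow> complex" where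
  "fock_inner u v = (\<Sum>n. \<integral>K. cnj (u n K) * v n K \<partial>photons_measure n)"

lemma integrable_weight2: "integrable (photons_measure n) (\<lambda>K. (weight n K)\<^sup>2)"
proof (rule integrableI_nonneg)
  have [measurable]: "(\<lambda>K. g (K j)) \<in> borel_measurable (photons_measure n)" if "j < n" for j
    by (rule measurable_compose[OF measurable_component[OF that] g_measurable])
  show "(\<lambda>K. (weight n K)\<^sup>2) \<in> borel_measurable (photons_measure n)"
    by measurable
qed (simp_all add: nn_integral_weight)

lemma integrable_weight_bound:
  fixes F :: "(nat \<Rightarrow> photon) \<Rightarrow> complex"
  assumes "F \<in> borel_measurable (photons_measure n)"
    and "\<And>K. cmod (F K) \<le> c * (weight n K)\<^sup>2"
  shows "integrable (photons_measure n) F"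
proof (rule Bochner_Integration.integrable_bound[OF _ assms(1)])
  show "integrable (photons_measure n) (\<lambda>K. c * (weight n K)\<^sup>2)"
    by (intro integrable_mult_right integrable_weight2)
  show "AE K in photons_measure n. norm (F K) \<le> norm (c * (weight n K)\<^sup>2)"
    by (intro AE_I2) (metis assms(2) real_norm_def abs_ge_self order_trans)
qed

lemma integrable_inner:
  assumes u: "u \<in> regular" and v: "v \<in> regular"
  shows "integrable (photons_measure n) (\<lambda>K. cnj (u n K) * v n K)"
proof -
  obtain C N D M where CN: "dominated C N u" and DM: "dominated D M v"
    using u v regular_dominated by blast
  note [measurable] = regular_measurable[OF u] regular_measurable[OF v]
  show ?thesis
  proof (rule integrable_weight_bound)
    show "cmod (cnj (u n K) * v n K) \<le> C * D * (weight n K)\<^sup>2" for K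
      using mult_mono'[OF dominatedD'[OF CN] dominatedD'[OF DM], of n K n K]
      by (simp add: norm_mult power2_eq_square mult_ac)
  qed measurable
qed

lemma fock_inner_eq_sum:
  assumes "dominated C N u"
  shows "fock_inner u v = (\<Sum>n\<le>N. \<integral>K. cnj (u n K) * v n K \<partial>photons_measure n)"
  unfolding fock_inner_def
proof (rule suminf_finite)
  fix n assume "n \<notin> {..N}"
  then have "u n K = 0" for K
    using dominatedD[OF assms, of n K] by simp
  then show "(\<integral>K. cnj (u n K) * v n K \<partial>photons_measure n) = 0" by simp
qed simp

lemma fock_inner_add:
  assumes "u \<in> regular" "v \<in> regular" "w \<in> regular"
  shows "fock_inner u (\<lambda>n K. v n K + w n K) = fock_inner u v + fock_inner u w"
proof -
  obtain C N where "dominated C N u"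
    using assms(1)[THEN regular_dominated] by blast
  then show ?thesis
    by (simp add: fock_inner_eq_sum distrib_left integrable_inner assms sum.distrib)
qed

lemma fock_inner_scale:
  assumes "u \<in> regular"
  shows "fock_inner u (\<lambda>n K. c * v n K) = c * fock_inner u v"
proof -
  obtain C N where "dominated C N u"
    using assms(1)[THEN regular_dominated] by blast
  then show ?thesis
    by (simp add: fock_inner_eq_sum mult.left_commute[of _ c] sum_distrib_left)
qed

lemma fock_inner_sum:
  assumes "u \<in> regular" "\<And>i. i \<in> I \<Longrightarrow> v i \<in> regular"
  shows "fock_inner u (\<lambda>n K. \<Sum>i\<in>I. v i n K) = (\<Sum>i\<in>I. fock_inner u (v i))"
  using assms(2)
proof (induction I rule: infinite_finite_induct)
  case (insert i I)
  then have "fock_inner u (\<lambda>n K. v i n K + (\<Sum>i\<in>I. v i n K)) =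
      fock_inner u (v i) + fock_inner u (\<lambda>n K. \<Sum>i\<in>I. v i n K)"
    by (intro fock_inner_add assms(1) regular_sum) auto
  then show ?case
    using insert by simp
qed (simp_all add: fock_inner_def)

lemma fock_inner_cnj:
  assumes "u \<in> regular" "v \<in> regular"
  shows "fock_inner v u = cnj (fock_inner u v)"
proof -
  obtain C N D M where "dominated C N u" "dominated D M v"
    using assms[THEN regular_dominated] by blast
  then have u: "dominated C (max N M) u" and v: "dominated D (max N M) v"
    using dominated_mono by auto
  have "(\<integral>K. cnj (v n K) * u n K \<partial>photons_measure n) =
      cnj (\<integral>K. cnj (u n K) * v n K \<partial>photons_measure n)" for n
    by (subst Bochner_Integration.integral_cnj[symmetric]) (simp add: mult.commute)
  then show ?thesis
    unfolding fock_inner_eq_sum[OF u] fock_inner_eq_sum[OF v] cnj_sum by (intro sum.cong refl)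
qed

text \<open>By symmetry of \<open>u\<close> all \<open>Suc n\<close> summands of the creation
  operator give the same integral, and \<open>Suc n / sqrt (Suc n)\<close> is the normalisation of
  annihilation.\<close>

lemma creation_adjoint:
  assumes f: "form_factor f" and u: "u \<in> regular" and v: "v \<in> regular"
  shows "(\<integral>K. cnj (u (Suc n) K) * creation f v (Suc n) K \<partial>photons_measure (Suc n)) =
    (\<integral>K. cnj (annihilation f u n K) * v n K \<partial>photons_measure n)"
proof -
  interpret N: sigma_finite_measure "photons_measure n" by (rule sigma_finite_photons)
  interpret pair: pair_sigma_finite photon_measure "photons_measure n" ..
  obtain C N D M where CN: "dominated C N u" and DM: "dominated D M v"
    using u v regular_dominated by blast
  note [measurable] = form_factor_measurable[OF f] regular_measurable[OF u] regular_measurable[OF v]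
  define I where "I = (\<integral>K. (\<integral>q. f q * cnj (u (Suc n) (case_nat q K)) \<partial>photon_measure) * v n K \<partial>photons_measure n)"
  define F where "F j K = cnj (u (Suc n) K) * (f (K j) * v n (\<lambda>i. K (skip j i)))" for j K
  have F_meas: "F j \<in> borel_measurable (photons_measure (Suc n))" if "j \<le> n" for j
  proof -
    have [measurable]: "(\<lambda>K. v n (\<lambda>i. K (skip j i))) \<in> borel_measurable (photons_measure (Suc n))"
      "(\<lambda>K. f (K j)) \<in> borel_measurable (photons_measure (Suc n))"
      using that by (auto intro!: measurable_compose[OF measurable_skip] measurable_compose[OF measurable_component])
    show ?thesis unfolding F_def by measurable
  qed
  have F_int: "integrable (photons_measure (Suc n)) (F j)" if "j \<le> n" for j
  proof (rule integrable_weight_bound[OF F_meas[OF that]])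
    fix K
    have "cmod (F j K) \<le> (C * weight (Suc n) K) * (g (K j) * (D * weight n (\<lambda>i. K (skip j i))))"
      unfolding F_def norm_mult complex_mod_cnj
      by (intro mult_mono dominatedD'[OF CN] dominatedD'[OF DM] form_factor_le[OF f] norm_ge_zero
          mult_nonneg_nonneg g_nonneg weight_nonneg dominated_const_nonneg[OF CN])
    also have "\<dots> = C * D * (weight (Suc n) K)\<^sup>2"
      unfolding prod_lessThan_Suc_skip[OF that] power2_eq_square by (simp add: mult_ac)
    finally show "cmod (F j K) \<le> C * D * (weight (Suc n) K)\<^sup>2" .
  qed
  have F_eq: "(\<integral>K. F j K \<partial>photons_measure (Suc n)) = I" if "j \<le> n" for j
  proof -
    have *: "F j (insert_at j q K) = f q * cnj (u (Suc n) (case_nat q K)) * v n K" for q K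
    proof -
      have "u (Suc n) (insert_at j q K) = u (Suc n) (case_nat q K)"
        by (rule regular_cong[OF u]) (simp add: entries_insert_at that entries_case_nat)
      then show ?thesis by (simp add: F_def)
    qed
    have "(\<integral>K. F j K \<partial>photons_measure (Suc n)) =
        (\<integral>p. F j ((\<lambda>(q, K). insert_at j q K) p) \<partial>(photon_measure \<Otimes>\<^sub>M photons_measure n))"
      by (subst distr_insert_at[OF that, symmetric], rule integral_distr[OF measurable_insert_at[OF that] F_meas[OF that]])
    also have "\<dots> = (\<integral>(q, K). f q * cnj (u (Suc n) (case_nat q K)) * v n K \<partial>(photon_measure \<Otimes>\<^sub>M photons_measure n))"
      by (simp add: split_beta' *)
    also have "\<dots> = (\<integral>K. \<integral>q. f q * cnj (u (Suc n) (case_nat q K)) * v n K \<partial>photon_measure \<partial>photons_measure n)"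
    proof (rule pair.integral_snd[symmetric])
      have "integrable (photon_measure \<Otimes>\<^sub>M photons_measure n) (\<lambda>p. F j ((\<lambda>(q, K). insert_at j q K) p))"
        by (subst integrable_distr_eq[OF measurable_insert_at[OF that] F_meas[OF that], symmetric])
          (simp add: distr_insert_at that F_int)
      then show "integrable (photon_measure \<Otimes>\<^sub>M photons_measure n)
          (\<lambda>(q, K). f q * cnj (u (Suc n) (case_nat q K)) * v n K)"
        by (simp add: split_beta' *)
    qed
    finally show ?thesis by (simp add: I_def)
  qed
  have "(\<integral>K. cnj (u (Suc n) K) * creation f v (Suc n) K \<partial>photons_measure (Suc n)) =
      (\<integral>K. of_real (1 / sqrt (Suc n)) * (\<Sum>j<Suc n. F j K) \<partial>photons_measure (Suc n))"
    unfolding creation_Suc F_def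
    by (simp add: sum_distrib_left mult.left_commute[of _ "complex_of_real _"] del: sum.lessThan_Suc)
  also have "\<dots> = of_real (1 / sqrt (Suc n)) * (\<Sum>j<Suc n. \<integral>K. F j K \<partial>photons_measure (Suc n))"
    by (subst integral_mult_right_zero, subst Bochner_Integration.integral_sum) (auto intro: F_int)
  also have "\<dots> = of_real (real (Suc n) / sqrt (Suc n)) * I"
    by (simp add: F_eq del: sum.lessThan_Suc)
  also have "\<dots> = of_real (sqrt (real n + 1)) * I"
    using real_div_sqrt[of "real (Suc n)"] by (simp add: add.commute)
  also have "\<dots> = (\<integral>K. cnj (annihilation f u n K) * v n K \<partial>photons_measure n)"
    unfolding I_def annihilation_def
    by (simp add: Bochner_Integration.integral_cnj[symmetric] mult.assoc del: Bochner_Integration.integral_cnj)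
  finally show ?thesis .
qed

lemma fock_inner_segal:
  assumes f: "form_factor f" and u: "u \<in> regular" and v: "v \<in> regular"
  shows "fock_inner (segal f u) v = fock_inner u (segal f v)"
proof -
  obtain C N D M where "dominated C N u" "dominated D M v"
    using u v regular_dominated by blast
  then obtain L where u': "dominated C L u" and v': "dominated D L v"
    using dominated_mono[of C N u C "max N M"] dominated_mono[of D M v D "max N M"] by auto
  define a where "a u v n = (\<integral>K. cnj (u n K) * annihilation f v n K \<partial>photons_measure n)" for u v n
  \<comment> \<open>The right side turns into its conjugate when \<open>u\<close> and
    \<open>v\<close> are exchanged. It is stated for general arguments so that it can be used in
    both orders.\<close>
  have *: "fock_inner u (segal f v) = of_real (1 / sqrt 2) * (\<Sum>n\<le>L. a u v n + cnj (a v u n))"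
    if u: "u \<in> regular" and v: "v \<in> regular" and u': "dominated C L u" and v': "dominated D L v"
    for u v C D
  proof -
    define c where "c n = (\<integral>K. cnj (u n K) * creation f v n K \<partial>photons_measure n)" for n
    have ac: "c (Suc n) = cnj (a v u n)" for n
      unfolding c_def creation_adjoint[OF f u v] a_def
      by (simp add: Bochner_Integration.integral_cnj[symmetric] mult.commute del: Bochner_Integration.integral_cnj)
    \<comment> \<open>After the shift by one sector the creation terms only run over
      \<open>n < L\<close>. The missing top term is 0, as it involves the sector
      \<open>Suc L\<close> of \<open>u\<close>.\<close>
    have aL: "a v u L = 0"
      using dominatedD[OF u', of "Suc L"] by (simp add: a_def annihilation_def)
    have "(\<Sum>n\<le>L. c n) = (\<Sum>n<L. c (Suc n))"
      by (simp add: sum.atMost_shift c_def creation_0)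
    also have "\<dots> = (\<Sum>n\<le>L. cnj (a v u n))"
      by (simp add: ac lessThan_Suc_atMost[symmetric] aL)
    finally have "(\<Sum>n\<le>L. c n) = (\<Sum>n\<le>L. cnj (a v u n))" .
    moreover have "fock_inner u (segal f v) = of_real (1 / sqrt 2) * (\<Sum>n\<le>L. a u v n + c n)"
      unfolding fock_inner_eq_sum[OF u'] segal_def a_def c_def
      by (simp add: mult.left_commute[of _ "of_real _"] distrib_left sum_distrib_left
          integrable_inner regular_creation regular_annihilation f u v sum.distrib sum_divide_distrib add_divide_distrib)
    ultimately show ?thesis
      by (simp add: sum.distrib)
  qed
  have "fock_inner (segal f u) v = cnj (fock_inner v (segal f u))"
    by (intro fock_inner_cnj regular_segal f u v)
  also have "\<dots> = fock_inner u (segal f v)"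
    unfolding *[OF u v u' v'] *[OF v u v' u'] by (simp add: add.commute)
  finally show ?thesis .
qed

end

section \<open>The abstract spin-photon system\<close>

definition scale_state :: "complex \<Rightarrow> ('s \<Rightarrow> fock) \<Rightarrow> 's \<Rightarrow> fock" where
  "scale_state c \<psi> = (\<lambda>s n K. c * \<psi> s n K)"

lemma scale_state_apply [simp]: "scale_state c \<psi> s n K = c * \<psi> s n K"
  by (simp add: scale_state_def)

interpretation state: vector_space scale_state
  by unfold_locales (auto simp: fun_eq_iff algebra_simps)

lemma sum_state_apply: "(\<Sum>i\<in>I. \<psi> i) s n K = (\<Sum>i\<in>I. \<psi> i s n K)" for \<psi> :: "'i \<Rightarrow> 's \<Rightarrow> fock"
  by (induction I rule: infinite_finite_induct) simp_all

lemma integral_photons_0: "(\<integral>K. F K \<partial>photons_measure 0) = F (\<lambda>_. undefined)" for F :: "_ \<Rightarrow> complex"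
  by (simp add: photons_measure_def PiM_empty lebesgue_integral_count_space_finite)

text \<open>\<open>T\<close> is the spin energy shifted to have lowest eigenvalue 0, and the columns
  of \<open>V\<close> are an orthonormal eigenbasis with eigenvalues \<open>d\<close>. Nondegeneracy
  of the ground state is \<open>d_eq_0\<close>.\<close>

locale spin_photon = photon_weight +
  fixes V T :: "'s::finite \<Rightarrow> 's \<Rightarrow> complex" and d :: "'s \<Rightarrow> real" and t0 :: 's
    and I :: "'i set" and f :: "'i \<Rightarrow> photon \<Rightarrow> complex" and M :: "'i \<Rightarrow> 's \<Rightarrow> 's \<Rightarrow> complex"
  assumes form_factor: "\<And>i. i \<in> I \<Longrightarrow> form_factor (f i)"
    and M_hermitian: "\<And>i s t. cnj (M i s t) = M i t s"
    and T_hermitian: "\<And>s t. cnj (T s t) = T t s"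
    and V_row: "\<And>r s. (\<Sum>t\<in>UNIV. V s t * cnj (V r t)) = of_bool (s = r)"
    and V_column: "\<And>r t. (\<Sum>s\<in>UNIV. cnj (V s t) * V s r) = of_bool (t = r)"
    and T_V: "\<And>s t. (\<Sum>r\<in>UNIV. T s r * V r t) = of_real (d t) * V s t"
    and d_nonneg: "\<And>t. 0 \<le> d t"
    and d_eq_0: "\<And>t. d t = 0 \<longleftrightarrow> t = t0"
begin

definition states :: "('s \<Rightarrow> fock) set" where
  "states = {\<psi>. \<forall>s. \<psi> s \<in> regular}"

definition free :: "('s \<Rightarrow> fock) \<Rightarrow> 's \<Rightarrow> fock" where
  "free \<psi> s n K = of_real (photon_energy n K) * \<psi> s n K + (\<Sum>t\<in>UNIV. T s t * \<psi> t n K)"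

definition coupling :: "('s \<Rightarrow> fock) \<Rightarrow> 's \<Rightarrow> fock" where
  "coupling \<psi> s n K = (\<Sum>i\<in>I. \<Sum>t\<in>UNIV. M i s t * segal (f i) (\<psi> t) n K)"

text \<open>
  On the ground state component the denominator is \<open>0\<close> and Isabelle's \<open>inverse 0 = 0\<close> makes this the
  reduced resolvent of \<open>free\<close> at the eigenvalue \<open>0\<close>.
\<close>
definition resolvent :: "('s \<Rightarrow> fock) \<Rightarrow> 's \<Rightarrow> fock" where
  "resolvent w s n K = (\<Sum>t\<in>UNIV. V s t *
     (inverse (of_real (photon_energy n K + d t)) * (\<Sum>r\<in>UNIV. cnj (V r t) * w r n K)))"

definition photon_parity :: "('s \<Rightarrow> fock) \<Rightarrow> 's \<Rightarrow> fock" where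
  "photon_parity \<psi> s n K = (-1) ^ n * \<psi> s n K"

definition ground :: "'s \<Rightarrow> fock" where
  "ground s n K = V s t0 * vacuum n K"

text \<open>The spin sum stands inside the integral so that the symmetry of \<open>free\<close> is
  an equality of integrands. It then holds without integrability, even for vectors that
  \<open>free\<close> takes out of \<open>states\<close>.\<close>

definition state_inner :: "('s \<Rightarrow> fock) \<Rightarrow> ('s \<Rightarrow> fock) \<Rightarrow> complex" where
  "state_inner \<psi> \<phi> = (\<Sum>n. \<integral>K. (\<Sum>s\<in>UNIV. cnj (\<psi> s n K) * \<phi> s n K) \<partial>photons_measure n)"

lemma states_regular: "\<psi> \<in> states \<Longrightarrow> \<psi> s \<in> regular"
  by (simp add: states_def)

lemma states_dominated:
  assumes "\<psi> \<in> states"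
  shows "\<exists>C N. \<forall>s. dominated C N (\<psi> s)"
proof -
  have "\<forall>s. \<exists>C N. dominated C N (\<psi> s)"
    using assms regular_dominated by (auto simp: states_def)
  then obtain C N where CN: "\<And>s. dominated (C s) (N s) (\<psi> s)"
    by metis
  have "dominated (Max (range C)) (Max (range N)) (\<psi> s)" for s
    by (rule dominated_mono[OF CN[of s]]) auto
  then show ?thesis by blast
qed

lemma subspace_states: "state.subspace states"
proof (rule state.subspaceI)
  show "0 \<in> states"
    using regular_zero by (simp add: states_def zero_fun_def)
  show "\<psi> + \<phi> \<in> states" if "\<psi> \<in> states" "\<phi> \<in> states" for \<psi> \<phi>
    using that by (auto simp: states_def plus_fun_def intro: regular_add)
  show "scale_state c \<psi> \<in> states" if "\<psi> \<in> states" for c \<psi>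
    using that by (auto simp: states_def scale_state_def intro: regular_scale)
qed

lemma ground_in: "ground \<in> states"
  unfolding states_def ground_def[abs_def] by (auto intro: regular_scale vacuum_regular)

lemma coupling_in:
  assumes "\<psi> \<in> states"
  shows "coupling \<psi> \<in> states"
proof -
  have "coupling \<psi> s \<in> regular" for s
    unfolding coupling_def[abs_def]
    by (intro regular_sum regular_scale regular_segal form_factor states_regular assms)
  then show ?thesis
    by (simp add: states_def)
qed

lemma resolvent_in:
  assumes "w \<in> states"
  shows "resolvent w \<in> states"
proof -
  have "(\<lambda>n K. inverse (of_real (photon_energy n K + d t)) * (\<Sum>r\<in>UNIV. cnj (V r t) * w r n K)) \<in> regular"
    for t
  \<comment> \<open>At energy 0 the multiplier is \<open>inverse (d t)\<close>, which is 0 for the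
    ground state, and from \<open>\<epsilon>\<close> on it is at most
    \<open>inverse \<epsilon>\<close>; the sum covers both.\<close>
  proof (rule regular_multiplier[where \<rho> = "\<lambda>e. inverse (of_real (e + d t))" and c = "inverse \<epsilon> + inverse (d t)"])
    show "cmod (inverse (of_real (0 + d t))) \<le> inverse \<epsilon> + inverse (d t)"
      using eps d_nonneg[of t] by (simp add: norm_inverse)
    show "cmod (inverse (of_real (e + d t))) \<le> inverse \<epsilon> + inverse (d t)" if "\<epsilon> \<le> e" for e
    proof -
      have "cmod (inverse (of_real (e + d t))) = inverse (e + d t)"
        unfolding norm_inverse norm_of_real using eps d_nonneg[of t] that by simp
      also have "\<dots> \<le> inverse \<epsilon>"
        using eps d_nonneg[of t] that by (intro le_imp_inverse_le) auto
      finally show ?thesis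
        using d_nonneg[of t] by (simp add: add_increasing2)
    qed
    show "(\<lambda>n K. \<Sum>r\<in>UNIV. cnj (V r t) * w r n K) \<in> regular"
      by (intro regular_sum regular_scale states_regular assms)
  qed measurable
  then show ?thesis
    unfolding states_def resolvent_def[abs_def] by (auto intro!: regular_sum regular_scale)
qed

lemma state_inner_eq:
  assumes "\<psi> \<in> states" "\<phi> \<in> states"
  shows "state_inner \<psi> \<phi> = (\<Sum>s\<in>UNIV. fock_inner (\<psi> s) (\<phi> s))"
proof -
  obtain C N where CN: "\<And>s. dominated C N (\<psi> s)"
    using states_dominated[OF assms(1)] by blast
  have "state_inner \<psi> \<phi> = (\<Sum>n\<le>N. \<integral>K. (\<Sum>s\<in>UNIV. cnj (\<psi> s n K) * \<phi> s n K) \<partial>photons_measure n)"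
    unfolding state_inner_def
  proof (rule suminf_finite)
    fix n assume "n \<notin> {..N}"
    then have "\<psi> s n K = 0" for s K
      using dominatedD[OF CN, of s n K] by simp
    then show "(\<integral>K. (\<Sum>s\<in>UNIV. cnj (\<psi> s n K) * \<phi> s n K) \<partial>photons_measure n) = 0" by simp
  qed simp
  also have "\<dots> = (\<Sum>n\<le>N. \<Sum>s\<in>UNIV. \<integral>K. cnj (\<psi> s n K) * \<phi> s n K \<partial>photons_measure n)"
    by (intro sum.cong refl Bochner_Integration.integral_sum integrable_inner states_regular assms)
  also have "\<dots> = (\<Sum>s\<in>UNIV. fock_inner (\<psi> s) (\<phi> s))"
    unfolding fock_inner_eq_sum[OF CN] by (rule sum.swap)
  finally show ?thesis .
qed

text \<open>\<open>ground\<close> lives in the sector without photons, whose measure is a point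
  mass; functions in that sector do not depend on \<open>K\<close>.\<close>

lemma state_inner_ground:
  assumes "w \<in> states"
  shows "state_inner ground w = (\<Sum>s\<in>UNIV. cnj (V s t0) * w s 0 K)"
proof -
  have "fock_inner (ground s) (w s) = cnj (V s t0) * w s 0 K" for s
  proof -
    have "dominated (cmod (V s t0)) 0 (ground s)"
      by (simp add: dominated_def ground_def vacuum_def)
    then have "fock_inner (ground s) (w s) = cnj (V s t0) * w s 0 (\<lambda>_. undefined)"
      by (simp add: fock_inner_eq_sum integral_photons_0 ground_def vacuum_def)
    also have "w s 0 (\<lambda>_. undefined) = w s 0 K"
      by (rule regular_cong[OF states_regular[OF assms]]) (simp add: entries_def)
    finally show ?thesis .
  qed
  then show ?thesis
    by (simp add: state_inner_eq[OF ground_in assms])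
qed

lemma free_resolvent:
  assumes w: "w \<in> states" and "state_inner ground w = 0"
  shows "free (resolvent w) = w"
proof (intro ext)
  fix s n K
  define y where "y t = (\<Sum>r\<in>UNIV. cnj (V r t) * w r n K)" for t
  define e where "e t = photon_energy n K + d t" for t
  \<comment> \<open>The denominator vanishes only at zero energy and \<open>t = t0\<close>. Without
    photons, \<open>y t0\<close> is the inner product with \<open>ground\<close>, which is 0 by
    assumption; with photons, \<open>w\<close> vanishes at zero energy.\<close>
  have e: "e t = 0 \<Longrightarrow> y t = 0" for t
  proof -
    assume "e t = 0"
    then have *: "photon_energy n K = 0" "t = t0"
      using photon_energy_nonneg[of n K] d_nonneg[of t] d_eq_0[of t] by (auto simp: e_def)
    show "y t = 0"
    proof (cases n)
      case 0
      then show ?thesis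
        using assms(2) state_inner_ground[OF w, of K] * by (simp add: y_def)
    next
      case (Suc m)
      then have "w r n K = 0" for r
        using photon_energy_ge[OF states_regular[OF w], of r n K] eps * by auto
      then show ?thesis by (simp add: y_def)
    qed
  qed
  have "free (resolvent w) s n K = of_real (photon_energy n K) * (\<Sum>t\<in>UNIV. V s t * (inverse (of_real (e t)) * y t))
      + (\<Sum>r\<in>UNIV. \<Sum>t\<in>UNIV. T s r * (V r t * (inverse (of_real (e t)) * y t)))"
    by (simp add: free_def resolvent_def y_def e_def sum_distrib_left)
  also have "(\<Sum>r\<in>UNIV. \<Sum>t\<in>UNIV. T s r * (V r t * (inverse (of_real (e t)) * y t))) =
      (\<Sum>t\<in>UNIV. (\<Sum>r\<in>UNIV. T s r * V r t) * (inverse (of_real (e t)) * y t))"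
    by (subst sum.swap) (simp add: sum_distrib_right mult.assoc)
  also have "of_real (photon_energy n K) * (\<Sum>t\<in>UNIV. V s t * (inverse (of_real (e t)) * y t)) + \<dots> =
      (\<Sum>t\<in>UNIV. V s t * (of_real (e t) * inverse (of_real (e t)) * y t))"
    unfolding T_V e_def by (simp add: sum_distrib_left sum.distrib[symmetric] algebra_simps)
  also have "\<dots> = (\<Sum>t\<in>UNIV. V s t * y t)"
  proof (intro sum.cong refl arg_cong2[where f = "(*)"])
    show "of_real (e t) * inverse (of_real (e t)) * y t = y t" for t
      using e[of t] by (cases "e t = 0") auto
  qed
  also have "\<dots> = (\<Sum>r\<in>UNIV. (\<Sum>t\<in>UNIV. V s t * cnj (V r t)) * w r n K)"
    unfolding y_def sum_distrib_left sum_distrib_right by (subst sum.swap) (simp add: mult.assoc)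
  also have "\<dots> = w s n K"
    unfolding V_row by simp
  finally show "free (resolvent w) s n K = w s n K" .
qed

lemma state_inner_ground_resolvent:
  assumes "w \<in> states"
  shows "state_inner ground (resolvent w) = 0"
proof -
  define y where "y t = inverse (of_real (d t)) * (\<Sum>r\<in>UNIV. cnj (V r t) * w r 0 undefined)" for t
  have "state_inner ground (resolvent w) = (\<Sum>s\<in>UNIV. \<Sum>t\<in>UNIV. cnj (V s t0) * (V s t * y t))"
    by (simp add: state_inner_ground[OF resolvent_in[OF assms], of undefined] resolvent_def y_def
        sum_distrib_left)
  also have "\<dots> = (\<Sum>t\<in>UNIV. (\<Sum>s\<in>UNIV. cnj (V s t0) * V s t) * y t)"
    by (subst sum.swap) (simp add: sum_distrib_right mult.assoc)
  \<comment> \<open>Orthonormality leaves only \<open>t = t0\<close>, where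
    \<open>inverse 0 = 0\<close> removes the term.\<close>
  also have "\<dots> = 0"
    unfolding V_column using d_eq_0[of t0] by (simp add: y_def)
  finally show ?thesis .
qed

lemma coupling_symmetric:
  assumes \<psi>: "\<psi> \<in> states" and \<phi>: "\<phi> \<in> states"
  shows "state_inner (coupling \<psi>) \<phi> = state_inner \<psi> (coupling \<phi>)"
proof -
  have *: "state_inner \<psi> (coupling \<phi>) =
      (\<Sum>i\<in>I. \<Sum>s\<in>UNIV. \<Sum>t\<in>UNIV. M i s t * fock_inner (\<psi> s) (segal (f i) (\<phi> t)))"
    if \<psi>: "\<psi> \<in> states" and \<phi>: "\<phi> \<in> states" for \<psi> \<phi>
  proof -
    have "fock_inner (\<psi> s) (coupling \<phi> s) =
        (\<Sum>i\<in>I. \<Sum>t\<in>UNIV. M i s t * fock_inner (\<psi> s) (segal (f i) (\<phi> t)))" for s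
      unfolding coupling_def[abs_def]
      using \<psi> \<phi> by (simp add: fock_inner_sum fock_inner_scale regular_sum regular_scale regular_segal
          form_factor states_regular)
    then show ?thesis
      unfolding state_inner_eq[OF \<psi> coupling_in[OF \<phi>]] by (simp add: sum.swap[of _ I])
  qed
  have "state_inner (coupling \<psi>) \<phi> = cnj (state_inner \<phi> (coupling \<psi>))"
    unfolding state_inner_eq[OF \<phi> coupling_in[OF \<psi>]] state_inner_eq[OF coupling_in[OF \<psi>] \<phi>] cnj_sum
    by (intro sum.cong refl fock_inner_cnj states_regular coupling_in \<psi> \<phi>)
  also have "\<dots> = (\<Sum>i\<in>I. \<Sum>s\<in>UNIV. \<Sum>t\<in>UNIV. M i t s * cnj (fock_inner (\<phi> s) (segal (f i) (\<psi> t))))"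
    unfolding *[OF \<phi> \<psi>] by (simp add: M_hermitian)
  also have "\<dots> = (\<Sum>i\<in>I. \<Sum>s\<in>UNIV. \<Sum>t\<in>UNIV. M i t s * fock_inner (\<psi> t) (segal (f i) (\<phi> s)))"
  proof (intro sum.cong refl arg_cong2[where f = "(*)"])
    fix i s t assume "i \<in> I"
    then show "cnj (fock_inner (\<phi> s) (segal (f i) (\<psi> t))) = fock_inner (\<psi> t) (segal (f i) (\<phi> s))"
      using \<psi> \<phi> by (simp add: fock_inner_cnj[symmetric] fock_inner_segal form_factor regular_segal states_regular)
  qed
  also have "\<dots> = state_inner \<psi> (coupling \<phi>)"
    unfolding *[OF \<psi> \<phi>] by (rule sum.cong[OF refl], rule sum.swap)
  finally show ?thesis .
qed

lemma free_symmetric: "state_inner (free \<psi>) \<phi> = state_inner \<psi> (free \<phi>)"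
proof -
  have "(\<Sum>s\<in>UNIV. \<Sum>t\<in>UNIV. cnj (T s t) * (cnj (\<psi> t n K) * \<phi> s n K)) =
      (\<Sum>s\<in>UNIV. \<Sum>t\<in>UNIV. T s t * (cnj (\<psi> s n K) * \<phi> t n K))" for n K
    unfolding T_hermitian by (rule sum.swap)
  then have "(\<Sum>s\<in>UNIV. cnj (free \<psi> s n K) * \<phi> s n K) = (\<Sum>s\<in>UNIV. cnj (\<psi> s n K) * free \<phi> s n K)" for n K
    by (simp add: free_def distrib_left distrib_right sum.distrib sum_distrib_left sum_distrib_right mult_ac)
  then show ?thesis
    by (simp add: state_inner_def)
qed

lemma coupling_parity: "photon_parity (coupling \<psi>) = - coupling (photon_parity \<psi>)"
proof -
  have "segal h (\<lambda>n K. (-1) ^ n * u n K) n K = - ((-1) ^ n * segal h u n K)" for h u n K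
  proof -
    have "creation h (\<lambda>n K. (-1) ^ n * u n K) n K = - ((-1) ^ n * creation h u n K)"
    proof (cases n)
      case (Suc m)
      then show ?thesis
        by (simp add: creation_Suc mult.left_commute[of _ "(-1) ^ m"] sum_distrib_left[symmetric] del: sum.lessThan_Suc)
    qed (simp add: creation_0)
    moreover have "annihilation h (\<lambda>n K. (-1) ^ n * u n K) n K = - ((-1) ^ n * annihilation h u n K)"
      by (simp add: annihilation_def mult.left_commute[of _ "(-1) ^ n"])
    ultimately show ?thesis
      by (simp add: segal_def algebra_simps)
  qed
  then show ?thesis
    by (intro ext) (simp add: photon_parity_def[abs_def] coupling_def[abs_def] sum_negf sum_distrib_left mult.left_commute)
qed

text \<open>Among the operators, only the additivity of \<open>coupling\<close> is restricted to
  \<open>states\<close>: it splits an annihilation integral and so needs integrability.\<close>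

sublocale formal_perturbation scale_state states state_inner free coupling resolvent photon_parity ground
proof (unfold_locales, goal_cases)
  case (3 u v w)
  then show ?case
    by (simp add: state_inner_eq state.subspace_add[OF subspace_states] plus_fun_apply[of v w])
      (simp add: plus_fun_def fock_inner_add states_regular sum.distrib)
next
  case (4 c u v)
  then show ?case
    by (simp add: state_inner_eq state.subspace_scale[OF subspace_states])
      (simp add: scale_state_def fock_inner_scale states_regular sum_distrib_left)
next
  case (5 u v)
  then show ?case
    by (simp only: state_inner_eq cnj_sum) (intro sum.cong refl fock_inner_cnj states_regular)
next
  case 6
  then show ?case
    by (simp add: state_inner_ground[OF ground_in, of undefined]) (simp add: ground_def vacuum_def V_column)
next
  case (7 u v)
  then show ?case
    by (intro ext) (simp add: free_def distrib_left sum.distrib)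
next
  case (8 c u)
  then show ?case
    by (intro ext) (simp add: free_def distrib_left sum_distrib_left mult_ac)
next
  case 10
  then show ?case
    using T_V[of _ t0] d_eq_0[of t0]
    by (intro ext) (simp add: free_def ground_def vacuum_def mult.assoc[symmetric] sum_distrib_right[symmetric])
next
  case (12 u v)
  then show ?case
    by (intro ext) (simp add: coupling_def plus_fun_def segal_add form_factor states_regular distrib_left sum.distrib)
next
  case (13 c u)
  then show ?case
    by (intro ext) (simp add: coupling_def scale_state_def segal_scale sum_distrib_left mult_ac)
next
  case (16 c w)
  then show ?case
    by (intro ext) (simp add: resolvent_def sum_distrib_left mult_ac)
next
  case (19 u v)
  then show ?case
    by (intro ext) (simp add: photon_parity_def distrib_left)
next
  case (22 u)
  then show ?case
    by (intro ext) (simp add: photon_parity_def resolvent_def sum_distrib_left mult_ac)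
next
  case 23
  then show ?case
    by (intro ext) (simp add: photon_parity_def ground_def vacuum_def)
next
  case (24 u v)
  have "(-1) ^ n * a * ((-1) ^ n * b) = a * b" for a b :: complex and n
    by (cases "even n") auto
  note * = this
  show ?case
    by (simp add: photon_parity_def[abs_def] state_inner_def *)
qed (auto simp: subspace_states ground_in free_symmetric coupling_in coupling_symmetric resolvent_in
    free_resolvent state_inner_ground_resolvent coupling_parity photon_parity_def fun_eq_iff)

end

section \<open>Diagonalisation of the spin Hamiltonian\<close>

text \<open>Distributivity over spin configurations; it reduces the orthogonality relations for all
  spins to those of a single spin.\<close>

lemma sum_prod_functions:
  fixes F :: "'a::finite \<Rightarrow> 'b::finite \<Rightarrow> 'c::comm_semiring_1"
  shows "(\<Sum>s\<in>UNIV. \<Prod>\<mu>\<in>UNIV. F \<mu> (s \<mu>)) = (\<Prod>\<mu>\<in>UNIV. \<Sum>i\<in>UNIV. F \<mu> i)"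
  using prod_sum_PiE[of "UNIV :: 'a set" "\<lambda>_. UNIV :: 'b set" F] by simp

lemma prod_of_bool_eq:
  "(\<Prod>\<mu>\<in>UNIV. of_bool (s \<mu> = r \<mu>)) = (of_bool (s = r) :: 'c::comm_semiring_1)"
  for s r :: "'a::finite \<Rightarrow> 'b"
proof (cases "s = r")
  case False
  then obtain \<mu> where "s \<mu> \<noteq> r \<mu>" by auto
  then show ?thesis
    using False by (auto intro!: prod_zero)
qed simp

lemma pauli_nth:
  "pauli 1 $ 1 $ 1 = 0" "pauli 1 $ 1 $ 2 = 1" "pauli 1 $ 2 $ 1 = 1" "pauli 1 $ 2 $ 2 = 0"
  "pauli 2 $ 1 $ 1 = 0" "pauli 2 $ 1 $ 2 = - \<i>" "pauli 2 $ 2 $ 1 = \<i>" "pauli 2 $ 2 $ 2 = 0"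
  "pauli 3 $ 1 $ 1 = 1" "pauli 3 $ 1 $ 2 = 0" "pauli 3 $ 2 $ 1 = 0" "pauli 3 $ 2 $ 2 = - 1"
  by (simp_all add: pauli_def)

lemma pauli_hermitian: "cnj (pauli m $ i $ j) = pauli m $ j $ i"
  using exhaust_3[of m] exhaust_2[of i] exhaust_2[of j] by (elim disjE) (simp_all add: pauli_nth)

lemma pauli_at_hermitian: "cnj (pauli_at l m $ s $ t) = pauli_at l m $ t $ s"
  unfolding pauli_at_def by (auto simp: pauli_hermitian mat_def intro!: prod.cong)

text \<open>A tensor product of matrices acts factorwise on a product vector, and only the factor
  \<open>l\<close> meets a matrix other than the identity.\<close>

lemma pauli_at_product:
  fixes c :: "'n::finite \<Rightarrow> complex ^ 2"
  shows "(\<Sum>r\<in>UNIV. pauli_at l m $ s $ r * (\<Prod>\<mu>\<in>UNIV. c \<mu> $ r \<mu>)) =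
    (pauli m *v c l) $ s l * (\<Prod>\<mu>\<in>UNIV - {l}. c \<mu> $ s \<mu>)"
proof -
  have "(\<Sum>r\<in>UNIV. pauli_at l m $ s $ r * (\<Prod>\<mu>\<in>UNIV. c \<mu> $ r \<mu>)) =
      (\<Prod>\<mu>\<in>UNIV. \<Sum>i\<in>UNIV. (if \<mu> = l then pauli m else mat 1) $ s \<mu> $ i * c \<mu> $ i)"
    by (simp add: pauli_at_def sum_prod_functions[symmetric] prod.distrib)
  also have "\<dots> = (\<Prod>\<mu>\<in>UNIV. ((if \<mu> = l then pauli m else mat 1) *v c \<mu>) $ s \<mu>)"
    by (simp add: matrix_vector_mult_def)
  also have "\<dots> = (pauli m *v c l) $ s l * (\<Prod>\<mu>\<in>UNIV - {l}. c \<mu> $ s \<mu>)"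
    by (subst prod.remove[of _ l]) (auto intro!: prod.cong)
  finally show ?thesis .
qed

text \<open>The eigenbasis consists of products of single-spin eigenvectors. The shifted eigenvalue
  \<open>d t\<close> is \<open>2 * norm \<beta>\<close> times the number of spins not in the state
  \<open>b0\<close>, so it vanishes only for \<open>t0\<close>.\<close>

lemma spin_diagonalisation:
  fixes \<beta> :: "real ^ 3" and b0 :: "complex ^ 2"
  assumes "\<beta> \<noteq> 0" "norm b0 = 1"
    and eigen: "(\<Sum>m\<in>UNIV. \<beta> $ m *\<^sub>R pauli m) *v b0 = (- norm \<beta>) *\<^sub>R b0"
  obtains V :: "('n::finite \<Rightarrow> 2) \<Rightarrow> ('n \<Rightarrow> 2) \<Rightarrow> complex" and d t0 where
    "\<And>s. V s t0 = spin_power b0 $ s"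
    "\<And>r s. (\<Sum>t\<in>UNIV. V s t * cnj (V r t)) = of_bool (s = r)"
    "\<And>r t. (\<Sum>s\<in>UNIV. cnj (V s t) * V s r) = of_bool (t = r)"
    "\<And>s t. (\<Sum>r\<in>UNIV. ((\<Sum>l\<in>UNIV. \<Sum>m\<in>UNIV. \<beta> $ m *\<^sub>R pauli_at l m) $ s $ r
        + of_real (real CARD('n) * norm \<beta>) * of_bool (s = r)) * V r t) = of_real (d t) * V s t"
    "\<And>t. 0 \<le> d t" "\<And>t. d t = 0 \<longleftrightarrow> t = t0"
proof -
  let ?B = "\<Sum>m\<in>UNIV. \<beta> $ m *\<^sub>R pauli m"
  \<comment> \<open>The second vector is the time reversal of \<open>b0\<close>: this antiunitary
    map anticommutes with the Pauli matrices, so it yields an orthogonal eigenvector for the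
    opposite eigenvalue. Concretely, its eigenvalue equations are the conjugates of those of
    \<open>b0\<close>.\<close>
  define b :: "2 \<Rightarrow> complex ^ 2" where
    "b i = (if i = 1 then b0 else vector [- cnj (b0 $ 2), cnj (b0 $ 1)])" for i
  define ev where "ev i = (if i = 1 then - norm \<beta> else norm \<beta>)" for i :: 2
  define V where "V s t = (\<Prod>\<mu>\<in>UNIV. b (t \<mu>) $ s \<mu>)" for s t :: "'n \<Rightarrow> 2"
  define d where "d t = (\<Sum>l\<in>UNIV. ev (t l) + norm \<beta>)" for t :: "'n \<Rightarrow> 2"
  define t0 :: "'n \<Rightarrow> 2" where "t0 = (\<lambda>_. 1)"
  have b_nth: "b 1 $ j = b0 $ j" "b 2 $ 1 = - cnj (b0 $ 2)" "b 2 $ 2 = cnj (b0 $ 1)" for j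
    by (simp_all add: b_def)
  have unit: "b0 $ 1 * cnj (b0 $ 1) + b0 $ 2 * cnj (b0 $ 2) = 1"
  proof -
    have "(cmod (b0 $ 1))\<^sup>2 + (cmod (b0 $ 2))\<^sup>2 = 1"
      using assms(2) by (simp add: norm_vec_def L2_set_def sum_2)
    then show ?thesis
      unfolding complex_norm_square[symmetric] of_real_add[symmetric] by simp
  qed
  note unit' = unit[unfolded mult.commute[of "b0 $ 1"] mult.commute[of "b0 $ 2"]]
    unit[unfolded add.commute[of "b0 $ 1 * _"]]
    unit[unfolded mult.commute[of "b0 $ 1"] mult.commute[of "b0 $ 2"] add.commute[of "cnj (b0 $ 1) * _"]]
  have row: "(\<Sum>i\<in>UNIV. b i $ j * cnj (b i $ k)) = of_bool (j = k)" for j k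
    using exhaust_2[of j] exhaust_2[of k] unit unit'
    by (elim disjE) (simp_all add: sum_2 b_nth mult.commute)
  have col: "(\<Sum>i\<in>UNIV. cnj (b j $ i) * b k $ i) = of_bool (j = k)" for j k
    using exhaust_2[of j] exhaust_2[of k] unit unit'
    by (elim disjE) (simp_all add: sum_2 b_nth mult.commute)
  have eig: "?B *v b i = ev i *\<^sub>R b i" for i
  proof -
    have 1: "\<beta> $ 3 * b0 $ 1 + Complex (\<beta> $ 1) (- \<beta> $ 2) * b0 $ 2 = - norm \<beta> * b0 $ 1"
      "Complex (\<beta> $ 1) (\<beta> $ 2) * b0 $ 1 - \<beta> $ 3 * b0 $ 2 = - norm \<beta> * b0 $ 2"
      using eigen[unfolded vec_eq_iff] unfolding forall_2
      by (simp_all add: matrix_vector_mult_def sum_2 sum_3 pauli_nth complex_eq_iff algebra_simps)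
    show ?thesis
      using exhaust_2[of i] 1 1[THEN arg_cong[of _ _ cnj]]
      by (elim disjE)
        (simp_all add: vec_eq_iff forall_2 matrix_vector_mult_def sum_2 sum_3 pauli_nth b_nth ev_def
          complex_eq_iff algebra_simps)
  qed
  have h1: "V s t0 = spin_power b0 $ s" for s
    by (simp add: V_def t0_def spin_power_def b_nth)
  have h2: "(\<Sum>t\<in>UNIV. V s t * cnj (V r t)) = of_bool (s = r)" for r s
  proof -
    have "(\<Sum>t\<in>UNIV. V s t * cnj (V r t)) = (\<Prod>\<mu>\<in>UNIV. \<Sum>i\<in>UNIV. b i $ s \<mu> * cnj (b i $ r \<mu>))"
      by (simp add: V_def sum_prod_functions[symmetric] prod.distrib)
    then show ?thesis
      by (simp add: row prod_of_bool_eq)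
  qed
  have h3: "(\<Sum>s\<in>UNIV. cnj (V s t) * V s r) = of_bool (t = r)" for r t
  proof -
    have "(\<Sum>s\<in>UNIV. cnj (V s t) * V s r) = (\<Prod>\<mu>\<in>UNIV. \<Sum>i\<in>UNIV. cnj (b (t \<mu>) $ i) * b (r \<mu>) $ i)"
      by (simp add: V_def sum_prod_functions[symmetric] prod.distrib)
    then show ?thesis
      by (simp add: col prod_of_bool_eq)
  qed
  have h4: "0 \<le> d t" for t
    unfolding d_def by (intro sum_nonneg) (simp add: ev_def)
  have h5: "d t = 0 \<longleftrightarrow> t = t0" for t
  proof -
    have "d t = 0 \<longleftrightarrow> (\<forall>l. ev (t l) + norm \<beta> = 0)"
      unfolding d_def by (subst sum_nonneg_eq_0_iff) (auto simp: ev_def)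
    also have "\<dots> \<longleftrightarrow> t = t0"
      using assms(1) by (auto simp: ev_def t0_def fun_eq_iff)
    finally show ?thesis .
  qed
  have h6: "(\<Sum>r\<in>UNIV. ((\<Sum>l\<in>UNIV. \<Sum>m\<in>UNIV. \<beta> $ m *\<^sub>R pauli_at l m) $ s $ r
        + of_real (real CARD('n) * norm \<beta>) * of_bool (s = r)) * V r t) = of_real (d t) * V s t" for s t
  proof -
    have "(\<Sum>r\<in>UNIV. (\<Sum>l\<in>UNIV. \<Sum>m\<in>UNIV. \<beta> $ m *\<^sub>R pauli_at l m) $ s $ r * V r t) =
        (\<Sum>r\<in>UNIV. \<Sum>l\<in>UNIV. \<Sum>m\<in>UNIV. of_real (\<beta> $ m) * (pauli_at l m $ s $ r * V r t))"
      by (simp add: sum_distrib_right) (simp add: scaleR_conv_of_real)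
    also have "\<dots> = (\<Sum>l\<in>UNIV. \<Sum>m\<in>UNIV. of_real (\<beta> $ m) * (\<Sum>r\<in>UNIV. pauli_at l m $ s $ r * V r t))"
      by (subst sum.swap, rule sum.cong[OF refl], subst sum.swap) (simp add: sum_distrib_left)
    also have "\<dots> = (\<Sum>l\<in>UNIV. (?B *v b (t l)) $ s l * (\<Prod>\<mu>\<in>UNIV - {l}. b (t \<mu>) $ s \<mu>))"
      unfolding V_def pauli_at_product
    proof (intro sum.cong refl)
      fix l
      have "(?B *v b (t l)) $ s l = (\<Sum>m\<in>UNIV. of_real (\<beta> $ m) * (pauli m *v b (t l)) $ s l)"
        by (simp add: matrix_vector_mult_def sum_2 sum_3) (simp add: scaleR_conv_of_real algebra_simps)
      then show "(\<Sum>m\<in>UNIV. of_real (\<beta> $ m) * ((pauli m *v b (t l)) $ s l * (\<Prod>\<mu>\<in>UNIV - {l}. b (t \<mu>) $ s \<mu>))) =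
          (?B *v b (t l)) $ s l * (\<Prod>\<mu>\<in>UNIV - {l}. b (t \<mu>) $ s \<mu>)"
        by (simp add: sum_distrib_right mult.assoc)
    qed
    also have "\<dots> = (\<Sum>l\<in>UNIV. of_real (ev (t l)) * V s t)"
    proof (intro sum.cong refl)
      fix l
      have "V s t = b (t l) $ s l * (\<Prod>\<mu>\<in>UNIV - {l}. b (t \<mu>) $ s \<mu>)"
        unfolding V_def by (rule prod.remove) auto
      then show "(?B *v b (t l)) $ s l * (\<Prod>\<mu>\<in>UNIV - {l}. b (t \<mu>) $ s \<mu>) = of_real (ev (t l)) * V s t"
        unfolding eig by simp (simp add: scaleR_conv_of_real)
    qed
    finally have "(\<Sum>r\<in>UNIV. (\<Sum>l\<in>UNIV. \<Sum>m\<in>UNIV. \<beta> $ m *\<^sub>R pauli_at l m) $ s $ r * V r t) =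
      of_real (\<Sum>l\<in>UNIV. ev (t l)) * V s t"
      by (simp add: sum_distrib_right)
    moreover have "(\<Sum>r\<in>UNIV. of_real (real CARD('n) * norm \<beta>) * of_bool (s = r) * V r t) =
        of_real (real CARD('n) * norm \<beta>) * V s t"
      by (simp only: mult.assoc sum_distrib_left[symmetric]) simp
    ultimately show ?thesis
      by (simp only: distrib_right sum.distrib) (simp add: d_def sum.distrib distrib_right)
  qed
  show thesis
    by (rule that[of V t0 d]) (fact h1 h2 h3 h6 h4 h5)+
qed

section \<open>Decay of the cutoff and integrability in three dimensions\<close>

lemma schwartz_measurable:
  assumes "schwartz f"
  shows "f \<in> borel_measurable borel"
proof -
  have "f differentiable at x" for x
    using assms unfolding schwartz_def by (metis funpow_0)
  then show ?thesis
    by (intro borel_measurable_continuous_onI continuous_at_imp_continuous_on)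
      (auto intro: differentiable_imp_continuous_within)
qed

text \<open>The exponent 3 is the dimension of momentum space, as needed for comparison with a
  product of one-dimensional functions.\<close>

lemma schwartz_weight_bound:
  assumes "schwartz f"
  obtains C where "\<And>r. r \<ge> 0 \<Longrightarrow> (f r)\<^sup>2 * r \<le> C * inverse ((1 + r\<^sup>2) ^ 3)"
proof -
  have "bounded (range (\<lambda>x. x ^ m * f x))" for m
    using assms unfolding schwartz_def by (metis funpow_0)
  then have "\<exists>B. \<forall>x. \<bar>x ^ m * f x\<bar> \<le> B" for m
    by (simp add: bounded_iff)
  then obtain B where B: "\<And>m x. \<bar>x ^ m * f x\<bar> \<le> B m"
    by metis
  \<comment> \<open>The coefficients of the expansion of \<open>(1 + r^2)^2\<close>, with each
    monomial times \<open>f\<close> bounded by its own constant.\<close>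
  define D where "D = B 0 + 2 * B 2 + B 4"
  show ?thesis
  proof
    fix r :: real assume r: "0 \<le> r"
    have "(1 + r\<^sup>2)\<^sup>2 * \<bar>f r\<bar> = \<bar>r ^ 0 * f r\<bar> + 2 * \<bar>r ^ 2 * f r\<bar> + \<bar>r ^ 4 * f r\<bar>"
      using r by (simp add: abs_mult power2_eq_square power4_eq_xxxx algebra_simps)
    also have "\<dots> \<le> D"
      unfolding D_def using B[of r 0] B[of r 2] B[of r 4] by linarith
    finally have "((1 + r\<^sup>2)\<^sup>2 * \<bar>f r\<bar>)\<^sup>2 \<le> D\<^sup>2"
      by (intro power_mono) auto
    have "r \<le> 1 + r\<^sup>2"
      using r zero_le_power2[of "r - 1"] by (simp add: power2_eq_square algebra_simps)
    then have "(f r)\<^sup>2 * r * (1 + r\<^sup>2) ^ 3 \<le> (f r)\<^sup>2 * (1 + r\<^sup>2) * (1 + r\<^sup>2) ^ 3"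
      by (intro mult_right_mono mult_left_mono) auto
    also have "\<dots> = ((1 + r\<^sup>2)\<^sup>2 * \<bar>f r\<bar>)\<^sup>2"
      by (simp add: power_mult_distrib power2_eq_square power3_eq_cube mult_ac)
    also note \<open>\<dots> \<le> D\<^sup>2\<close>
    finally show "(f r)\<^sup>2 * r \<le> D\<^sup>2 * inverse ((1 + r\<^sup>2) ^ 3)"
      by (simp add: field_simps add_pos_nonneg)
  qed
qed

text \<open>Each of the three factors \<open>1 + (norm k)^2\<close> is at least
  \<open>1 + (k \<bullet> b)^2\<close> for one basis vector \<open>b\<close>, so the integrand is at
  most a product of functions of one coordinate and no polar coordinates are used.\<close>

lemma nn_integral_inverse_power_finite:
  "(\<integral>\<^sup>+k. ennreal (inverse ((1 + (norm k)\<^sup>2) ^ 3)) \<partial>(lborel :: (real ^ 3) measure)) < \<infinity>"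
proof -
  have 1: "(\<integral>\<^sup>+x. ennreal (inverse (1 + x\<^sup>2)) \<partial>lborel) < \<infinity>"
  proof -
    have "integrable lborel (\<lambda>x::real. inverse (1 + x\<^sup>2))"
      using integrable_inverse_1_plus_square by (simp add: set_integrable_def einterval_def)
    then show ?thesis
      by (simp add: nn_integral_eq_integral)
  qed
  have "inverse ((1 + (norm k)\<^sup>2) ^ 3) \<le> (\<Prod>b\<in>Basis. inverse (1 + (k \<bullet> b)\<^sup>2))" for k :: "real ^ 3"
  proof -
    have "inverse ((1 + (norm k)\<^sup>2) ^ 3) = (\<Prod>b\<in>(Basis :: (real ^ 3) set). inverse (1 + (norm k)\<^sup>2))"
      by (simp add: power_inverse)
    also have "\<dots> \<le> (\<Prod>b\<in>Basis. inverse (1 + (k \<bullet> b)\<^sup>2))"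
    proof (intro prod_mono conjI le_imp_inverse_le)
      fix b :: "real ^ 3" assume "b \<in> Basis"
      then have "\<bar>k \<bullet> b\<bar> \<le> norm k" by (rule Basis_le_norm)
      then show "1 + (k \<bullet> b)\<^sup>2 \<le> 1 + (norm k)\<^sup>2"
        using power_mono[of "\<bar>k \<bullet> b\<bar>" "norm k" 2] by simp
    qed (auto simp: add_pos_nonneg)
    finally show ?thesis .
  qed
  then have "(\<integral>\<^sup>+k. ennreal (inverse ((1 + (norm k)\<^sup>2) ^ 3)) \<partial>(lborel :: (real ^ 3) measure)) \<le>
      (\<integral>\<^sup>+k. (\<Prod>b\<in>Basis. ennreal (inverse (1 + (k \<bullet> b)\<^sup>2))) \<partial>(lborel :: (real ^ 3) measure))"
    by (intro nn_integral_mono) (simp add: prod_ennreal ennreal_leI)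
  also have "\<dots> = (\<Prod>b\<in>(Basis :: (real ^ 3) set). \<integral>\<^sup>+x. ennreal (inverse (1 + x\<^sup>2)) \<partial>lborel)"
    by (rule nn_integral_lborel_prod) auto
  also have "\<dots> < \<infinity>"
    using 1 by (simp add: power_less_top_ennreal)
  finally show ?thesis .
qed

section \<open>Estimates\<close>

context photon_weight
begin

lemma state_norm_le:
  fixes \<psi> :: "('n::finite) state"
  assumes "\<And>s. dominated C N (\<psi> s)"
  shows "state_norm \<psi> \<le> C * sqrt (real CARD('n \<Rightarrow> 2) * (\<Sum>n\<le>N. (\<integral>q. (g q)\<^sup>2 \<partial>photon_measure) ^ n))"
proof -
  let ?S = "\<Sum>n\<le>N. (\<integral>q. (g q)\<^sup>2 \<partial>photon_measure) ^ n"
  have C: "0 \<le> C" by (rule dominated_const_nonneg[OF assms])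
  have S: "0 \<le> ?S" by (intro sum_nonneg zero_le_power integral_nonneg_AE) simp
  have "(\<Sum>s\<in>UNIV. fock_norm2 (\<psi> s)) \<le> (\<Sum>s\<in>(UNIV :: ('n \<Rightarrow> 2) set). ennreal (C\<^sup>2 * ?S))"
    by (intro sum_mono fock_norm2_le assms)
  also have "\<dots> = ennreal (C\<^sup>2 * (real CARD('n \<Rightarrow> 2) * ?S))"
    using S by (subst sum_ennreal) (simp_all add: mult_ac)
  finally have "enn2real (\<Sum>s\<in>UNIV. fock_norm2 (\<psi> s)) \<le> C\<^sup>2 * (real CARD('n \<Rightarrow> 2) * ?S)"
    using S by (intro enn2real_leI) auto
  then have "state_norm \<psi> \<le> sqrt (C\<^sup>2 * (real CARD('n \<Rightarrow> 2) * ?S))"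
    unfolding state_norm_def by (rule real_sqrt_le_mono)
  then show ?thesis
    using C by (simp add: real_sqrt_mult)
qed

lemma dominated_sum:
  assumes "finite I" "\<And>i. i \<in> I \<Longrightarrow> dominated (C i) N (u i)"
  shows "dominated (\<Sum>i\<in>I. C i) N (\<lambda>n K. \<Sum>i\<in>I. u i n K)"
  using assms
proof (induction I rule: finite_induct)
  case empty
  show ?case
    using dominated_mono[OF dominated_zero, of 0 N] by simp
next
  case (insert i I)
  then show ?case
    using dominated_add[of "C i" N "u i" "sum C I" N "\<lambda>n K. \<Sum>i\<in>I. u i n K"] by simp
qed

end

text \<open>\<open>C\<close> and \<open>N\<close> are fixed before \<open>h\<close> and
  \<open>s\<close>: the expansion involves finitely many vectors, and the remaining powers of
  \<open>s\<close> are at most 1.\<close>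

lemma (in spin_photon) residual_dominated:
  obtains C N where "\<And>h s :: real. \<And>\<sigma>. 0 \<le> s \<Longrightarrow> s \<le> 1 \<Longrightarrow> 0 \<le> h \<Longrightarrow> dominated (h * s ^ Suc J * C) N
    (scale_state (of_real h)
      (free (\<Sum>j\<le>J. scale_state (of_real s ^ j) (pert j)) +
       scale_state (of_real s) (coupling (\<Sum>j\<le>J. scale_state (of_real s ^ j) (pert j))) -
       scale_state (\<Sum>i\<le>J. corr i * of_real s ^ i) (\<Sum>j\<le>J. scale_state (of_real s ^ j) (pert j))) \<sigma>)"
proof -
  let ?D = "{(i, j). i \<le> J \<and> j \<le> J \<and> J < i + j}"
  have fin: "finite ?D"
    by (rule finite_subset[of _ "{..J} \<times> {..J}"]) auto
  obtain C1 N1 where 1: "\<And>\<sigma>. dominated C1 N1 (coupling (pert J) \<sigma>)"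
    using states_dominated[OF coupling_in[OF pert_in]] by blast
  obtain C N where 2: "\<And>j \<sigma>. dominated (C j) (N j) (pert j \<sigma>)"
    using states_dominated[OF pert_in] by metis
  define M where "M = Max (insert N1 (N ` {..J}))"
  have M: "N1 \<le> M" "j \<le> J \<Longrightarrow> N j \<le> M" for j
    unfolding M_def by (intro Max_ge; simp)+
  let ?C = "C1 + (\<Sum>(i, j)\<in>?D. cmod (corr i) * C j)"
  show ?thesis
  proof
    fix h s :: real and \<sigma> assume s: "0 \<le> s" "s \<le> 1" and h: "0 \<le> h"
    have 3: "dominated (\<Sum>(i, j)\<in>?D. cmod (corr i) * C j) M
      (\<lambda>n K. \<Sum>p\<in>?D. (case p of (i, j) \<Rightarrow> - (corr i * of_real s ^ (i + j - Suc J)) * pert j \<sigma> n K))"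
    proof (rule dominated_sum[OF fin], clarify)
      fix i j assume "i \<le> J" "j \<le> J"
      have "dominated (cmod (- (corr i * of_real s ^ (i + j - Suc J))) * C j) M
          (\<lambda>n K. - (corr i * of_real s ^ (i + j - Suc J)) * pert j \<sigma> n K)"
        by (intro dominated_scale dominated_mono[OF 2] M \<open>j \<le> J\<close> order_refl)
      moreover have "cmod (- (corr i * of_real s ^ (i + j - Suc J))) * C j \<le> cmod (corr i) * C j"
        using s dominated_const_nonneg[OF 2, of j]
        by (auto simp: norm_mult norm_power intro!: mult_right_mono mult_right_le_one_le power_le_one)
      ultimately show "dominated (cmod (corr i) * C j) M
          (\<lambda>n K. - (corr i * of_real s ^ (i + j - Suc J)) * pert j \<sigma> n K)"
        using dominated_mono by blast
    qed
    have "dominated (cmod (of_real (h * s ^ Suc J)) * ?C) M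
        (\<lambda>n K. of_real (h * s ^ Suc J) * (coupling (pert J) \<sigma> n K +
          (\<Sum>p\<in>?D. (case p of (i, j) \<Rightarrow> - (corr i * of_real s ^ (i + j - Suc J)) * pert j \<sigma> n K))))"
      using dominated_add[OF dominated_mono[OF 1 order_refl M(1)] 3] by (intro dominated_scale) simp
    note dom = this
    have eq: "cmod (of_real (h * s ^ Suc J)) * ?C = h * s ^ Suc J * ?C"
      unfolding norm_of_real using s h by simp
    show "dominated (h * s ^ Suc J * ?C) M
      (scale_state (of_real h)
      (free (\<Sum>j\<le>J. scale_state (of_real s ^ j) (pert j)) +
       scale_state (of_real s) (coupling (\<Sum>j\<le>J. scale_state (of_real s ^ j) (pert j))) -
       scale_state (\<Sum>i\<le>J. corr i * of_real s ^ i) (\<Sum>j\<le>J. scale_state (of_real s ^ j) (pert j))) \<sigma>)"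
      using dom[unfolded eq] unfolding residual_expansion
      by (rule back_subst[of "dominated _ _"])
        (simp add: fun_eq_iff sum_state_apply split_beta' sum_negf mult.assoc)
  qed
qed

text \<open>By Lagrange's identity the normalised cross product has norm at most 1; at
  \<open>k = 0\<close> it is 0 by the convention for \<open>inverse 0\<close>.\<close>

lemma mode_component_le:
  "\<bar>(c *\<^sub>R (cross3 k (axis m 1) /\<^sub>R norm k)) $ i\<bar> \<le> \<bar>c\<bar>"
proof -
  let ?v = "cross3 k (axis m 1) /\<^sub>R norm k"
  have "(norm (cross3 k (axis m 1)))\<^sup>2 \<le> (norm k * norm (axis m (1 :: real)))\<^sup>2"
    using norm_cross_dot[of k "axis m 1"] zero_le_power2[of "k \<bullet> axis m 1"] by linarith
  then have "norm (cross3 k (axis m 1)) \<le> norm k"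
    unfolding norm_axis_1 mult_1_right by (rule power2_le_imp_le) (rule norm_ge_zero)
  then have "norm ?v \<le> 1"
    by (simp add: divide_simps)
  then have "\<bar>c\<bar> * norm ?v \<le> \<bar>c\<bar>"
    by (rule mult_left_le) simp
  then show ?thesis
    using component_le_norm_cart[of "c *\<^sub>R ?v" i] unfolding norm_scaleR[of c ?v] by (rule order_trans[rotated])
qed

text \<open>One weight for all positions, directions and components. The factor 2 accommodates the
  real and imaginary parts, each bounded by half of it.\<close>

definition radial_weight :: "(real \<Rightarrow> real) \<Rightarrow> photon \<Rightarrow> real" where
  "radial_weight f q = 2 / (2 * pi) powr (3/2) * (\<bar>f (norm (fst q))\<bar> * sqrt (norm (fst q)))"

lemma measurable_photon_component:
  fixes F :: "real ^ 3 \<Rightarrow> real ^ 3"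
  assumes "F \<in> borel_measurable borel"
  shows "(\<lambda>(k, i). F k $ i) \<in> borel_measurable photon_measure"
proof -
  have [measurable]: "(\<lambda>k. F k $ i) \<in> borel_measurable borel" for i
    by (rule measurable_compose[OF assms]) (intro borel_measurable_continuous_onI continuous_intros)
  have "(\<lambda>p. F (fst p) $ i) \<in> borel_measurable (lborel \<Otimes>\<^sub>M count_space UNIV)" for i
    by (rule measurable_compose[OF measurable_fst]) simp
  then have "(\<lambda>p. F (fst p) $ snd p) \<in> borel_measurable (lborel \<Otimes>\<^sub>M count_space UNIV)"
    by (rule measurable_compose_countable[where g = snd]) measurable
  then show ?thesis
    by (simp add: photon_measure_def split_beta')
qed

lemma photon_weight_radial:
  assumes "schwartz f" and "\<forall>r. \<bar>r\<bar> < \<epsilon> \<longrightarrow> f r = 0" and "0 < \<epsilon>"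
  shows "photon_weight (radial_weight f) \<epsilon>"
proof
  note [measurable] = schwartz_measurable[OF assms(1)]
  show [measurable]: "radial_weight f \<in> borel_measurable photon_measure"
    unfolding radial_weight_def[abs_def] photon_measure_def by measurable
  show "integrable photon_measure (\<lambda>q. (radial_weight f q)\<^sup>2)"
  proof (rule integrableI_nonneg)
    interpret C: sigma_finite_measure "count_space (UNIV :: 3 set)"
      by (rule sigma_finite_measure_count_space_finite) simp
    obtain B where B: "\<And>r. r \<ge> 0 \<Longrightarrow> (f r)\<^sup>2 * r \<le> B * inverse ((1 + r\<^sup>2) ^ 3)"
      using schwartz_weight_bound[OF assms(1)] by blast
    have B0: "0 \<le> B"
      using B[of 0] by simp
    define c0 :: real where "c0 = 2 / (2 * pi) powr (3/2)"
    define c where "c = c0\<^sup>2 * B"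
    have "(radial_weight f q)\<^sup>2 \<le> c * inverse ((1 + (norm (fst q))\<^sup>2) ^ 3)" for q
      using mult_left_mono[OF B[of "norm (fst q)"], of "c0\<^sup>2"]
      unfolding radial_weight_def c0_def[symmetric] by (simp add: power_mult_distrib c_def mult.assoc)
    moreover have c: "0 \<le> c"
      using B0 by (simp add: c_def)
    ultimately have "(\<integral>\<^sup>+q. ennreal ((radial_weight f q)\<^sup>2) \<partial>photon_measure) \<le>
        (\<integral>\<^sup>+q. ennreal c * ennreal (inverse ((1 + (norm (fst q))\<^sup>2) ^ 3)) \<partial>photon_measure)"
      by (intro nn_integral_mono) (simp add: ennreal_mult'[symmetric])
    also have "\<dots> = ennreal c * (\<integral>\<^sup>+q. ennreal (inverse ((1 + (norm (fst q))\<^sup>2) ^ 3)) \<partial>photon_measure)"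
      unfolding photon_measure_def by (rule nn_integral_cmult) measurable
    also have "(\<integral>\<^sup>+q. ennreal (inverse ((1 + (norm (fst q))\<^sup>2) ^ 3)) \<partial>photon_measure) =
        (\<integral>\<^sup>+k. \<integral>\<^sup>+i. ennreal (inverse ((1 + (norm k)\<^sup>2) ^ 3)) \<partial>count_space (UNIV :: 3 set) \<partial>(lborel :: (real ^ 3) measure))"
      unfolding photon_measure_def by (subst C.nn_integral_fst[symmetric]) simp_all
    \<comment> \<open>The factor 3 is the number of components of the field.\<close>
    also have "\<dots> = (\<integral>\<^sup>+k. ennreal (inverse ((1 + (norm k)\<^sup>2) ^ 3)) * 3 \<partial>(lborel :: (real ^ 3) measure))"
      by (simp add: mult.commute)
    also have "\<dots> = (\<integral>\<^sup>+k. ennreal (inverse ((1 + (norm k)\<^sup>2) ^ 3)) \<partial>(lborel :: (real ^ 3) measure)) * 3"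
      by (rule nn_integral_multc) measurable
    also have "ennreal c * \<dots> < \<infinity>"
      using nn_integral_inverse_power_finite by (simp add: ennreal_mult_less_top)
    finally show "(\<integral>\<^sup>+q. ennreal ((radial_weight f q)\<^sup>2) \<partial>photon_measure) < \<infinity>" .
  qed auto
  show "0 < \<epsilon>" by fact
  show "radial_weight f q = 0" if "norm (fst q) < \<epsilon>" for q
    using assms(2) that by (simp add: radial_weight_def)
qed (simp add: radial_weight_def)

lemma form_factor_modes:
  assumes "schwartz f" and "photon_weight (radial_weight f) \<epsilon>"
  shows "photon_weight.form_factor (radial_weight f) (complexify (mode_a f m y) (mode_b f m y))"
proof -
  interpret photon_weight "radial_weight f" \<epsilon> by fact
  note [measurable] = schwartz_measurable[OF assms(1)]
  have [measurable]: "(\<lambda>k. cross3 k (axis m 1)) \<in> borel_measurable borel"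
    by (intro borel_measurable_continuous_onI continuous_on_cross continuous_intros)
  let ?a = "mode_a f m y" and ?b = "mode_b f m y"
  have meas: "?a \<in> borel_measurable borel" "?b \<in> borel_measurable borel"
    unfolding mode_a_def[abs_def] mode_b_def[abs_def] by measurable
  have le: "\<bar>?a k $ i\<bar> \<le> radial_weight f (k, i) / 2" "\<bar>?b k $ i\<bar> \<le> radial_weight f (k, i) / 2" for k i
  proof -
    have *: "\<bar>f (norm k) * sqrt (norm k) / (2 * pi) powr (3/2) * c\<bar> \<le> radial_weight f (k, i) / 2"
      if "\<bar>c\<bar> \<le> 1" for c
      using mult_left_mono[OF that, of "\<bar>f (norm k)\<bar> * sqrt (norm k) / (2 * pi) powr (3/2)"]
      by (simp add: radial_weight_def abs_mult mult_ac)
    show "\<bar>?a k $ i\<bar> \<le> radial_weight f (k, i) / 2" "\<bar>?b k $ i\<bar> \<le> radial_weight f (k, i) / 2"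
      unfolding mode_a_def mode_b_def
      by (rule order_trans[OF mode_component_le *], simp)+
  qed
  have orth: "(\<Sum>i\<in>UNIV. k $ i * ?a k $ i) = 0" "(\<Sum>i\<in>UNIV. k $ i * ?b k $ i) = 0" for k
  proof -
    have "k \<bullet> ?a k = 0" "k \<bullet> ?b k = 0"
      unfolding mode_a_def mode_b_def by (simp_all add: dot_cross_self)
    then show "(\<Sum>i\<in>UNIV. k $ i * ?a k $ i) = 0" "(\<Sum>i\<in>UNIV. k $ i * ?b k $ i) = 0"
      by (simp_all add: inner_vec_def)
  qed
  show ?thesis
    unfolding form_factor_def
  proof (intro conjI allI)
    note [measurable] = meas[THEN measurable_photon_component]
    have "complexify ?a ?b = (\<lambda>q. of_real ((\<lambda>(k, i). ?a k $ i) q) + \<i> * of_real ((\<lambda>(k, i). ?b k $ i) q))"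
      by (auto simp: complexify_def)
    also have "\<dots> \<in> borel_measurable photon_measure"
      by measurable
    finally show "complexify ?a ?b \<in> borel_measurable photon_measure" .
    show "cmod (complexify ?a ?b q) \<le> radial_weight f q" for q
    proof (cases q)
      case (Pair k i)
      have "cmod (complexify ?a ?b q) \<le> cmod (of_real (?a k $ i)) + cmod (\<i> * of_real (?b k $ i))"
        unfolding Pair complexify_def by (simp only: case_prod_conv) (rule norm_triangle_ineq)
      then show ?thesis
        using le[of k i] by (simp add: Pair norm_mult)
    qed
    show "(\<Sum>i\<in>UNIV. of_real (k $ i) * complexify ?a ?b (k, i)) = 0" for k
    proof -
      have "(\<Sum>i\<in>UNIV. of_real (k $ i) * complexify ?a ?b (k, i)) =
          of_real (\<Sum>i\<in>UNIV. k $ i * ?a k $ i) + \<i> * of_real (\<Sum>i\<in>UNIV. k $ i * ?b k $ i)"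
        by (simp add: complexify_def distrib_left sum.distrib sum_distrib_left mult_ac)
      then show ?thesis
        by (simp add: orth)
    qed
  qed
qed

section \<open>The quasimodes\<close>

lemma powr_half_nat: "0 < h \<Longrightarrow> h powr (real j / 2) = sqrt h ^ j"
  using powr_powr[of h "1/2" "real j"] by (simp add: powr_half_sqrt powr_realpow)

lemma (in formal_perturbation) sum_corr_even:
  "(\<Sum>i\<le>Suc (2 * r). corr i * s ^ i) = (\<Sum>q\<le>r. corr (2 * q) * (s\<^sup>2) ^ q)"
  by (induction r) (simp_all add: corr_odd power_mult power2_eq_square)

theorem theorem6p5:
  fixes cutoff :: "real \<Rightarrow> real" and \<beta> :: "real ^ 3" and x :: "'n::finite \<Rightarrow> real ^ 3"
    and b0 :: "complex ^ 2"
  assumes "schwartz cutoff"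
    and "eventually (\<lambda>r. cutoff r = 0) (nhds 0)"
    and "\<beta> \<noteq> 0"
    and "norm b0 = 1"
    and "(\<Sum>m\<in>UNIV. \<beta> $ m *\<^sub>R pauli m) *v b0 = (- norm \<beta>) *\<^sub>R b0"
  shows "\<exists>(u :: nat \<Rightarrow> 'n state) (lam :: nat \<Rightarrow> real).
    (\<forall>j. u j \<in> hamiltonian_domain cutoff x) \<and>
    u 0 = tensor_vec vacuum (spin_power b0) \<and>
    lam 1 = - real CARD('n) * norm \<beta> \<and>
    (\<forall>p::nat. \<exists>C::real. \<forall>h\<in>{0<..<1}.
      (let E = (\<Sum>i=1..p+1. lam i * h ^ i);
           \<psi> = partial_state u (2 * p) h;
           \<psi>' = partial_state u (2 * p + 1) h
       in \<psi> \<in> hamiltonian_domain cutoff x \<and> \<psi>' \<in> hamiltonian_domain cutoff x \<and>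
          residual cutoff \<beta> x h E \<psi> \<in> state_space \<and>
          state_norm (residual cutoff \<beta> x h E \<psi>) \<le> C * h powr (real p + 3/2) \<and>
          residual cutoff \<beta> x h E \<psi>' \<in> state_space \<and>
          state_norm (residual cutoff \<beta> x h E \<psi>') \<le> C * h powr (real p + 2)))"
proof -
  obtain \<epsilon> where \<epsilon>: "0 < \<epsilon>" "\<forall>r. \<bar>r\<bar> < \<epsilon> \<longrightarrow> cutoff r = 0"
    using assms(2) unfolding eventually_nhds_metric by (auto simp: dist_real_def)
  have weight: "photon_weight (radial_weight cutoff) \<epsilon>"
    using photon_weight_radial[OF assms(1) \<epsilon>(2,1)] .
  interpret photon_weight "radial_weight cutoff" \<epsilon> by (rule weight)
  define S where "S = (\<Sum>l\<in>UNIV. \<Sum>m\<in>UNIV. \<beta> $ m *\<^sub>R (pauli_at l m :: complex ^ ('n \<Rightarrow> 2) ^ ('n \<Rightarrow> 2)))"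
  define T where "T s r = S $ s $ r + of_real (real CARD('n) * norm \<beta>) * of_bool (s = r)" for s r
  obtain V :: "('n \<Rightarrow> 2) \<Rightarrow> ('n \<Rightarrow> 2) \<Rightarrow> complex" and d t0 where V0: "\<And>s. V s t0 = spin_power b0 $ s"
    and V: "\<And>r s. (\<Sum>t\<in>UNIV. V s t * cnj (V r t)) = of_bool (s = r)"
      "\<And>r t. (\<Sum>s\<in>UNIV. cnj (V s t) * V s r) = of_bool (t = r)"
      "\<And>s t. (\<Sum>r\<in>UNIV. T s r * V r t) = of_real (d t) * V s t"
    and d: "\<And>t. 0 \<le> d t" "\<And>t. d t = 0 \<longleftrightarrow> t = t0"
    by (rule spin_diagonalisation[OF assms(3-5), where 'n = 'n, folded S_def T_def]) blast
  define f where "f = (\<lambda>(l, m). complexify (mode_a cutoff m (x l)) (mode_b cutoff m (x l)))"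
  define M where "M = (\<lambda>(l, m) s t. (pauli_at l m :: complex ^ ('n \<Rightarrow> 2) ^ ('n \<Rightarrow> 2)) $ s $ t)"
  interpret spin_photon "radial_weight cutoff" \<epsilon> V T d t0 UNIV f M
  proof
    show "form_factor (f i)" for i
      unfolding f_def split_beta by (rule form_factor_modes[OF assms(1) weight])
    show "cnj (M i s t) = M i t s" for i s t
      by (simp add: M_def split_beta pauli_at_hermitian)
    show "cnj (T s t) = T t s" for s t
      by (auto simp: T_def S_def pauli_at_hermitian)
  qed (fact V d)+
  have field: "field_at cutoff x l m \<psi> s n K = (\<Sum>t\<in>UNIV. M (l, m) s t * segal (f (l, m)) (\<psi> t) n K)"
    for l m \<psi> s n K
    by (simp add: field_at_def tensor_op_def M_def f_def)
  have coupling: "coupling \<psi> s n K = (\<Sum>l\<in>UNIV. \<Sum>m\<in>UNIV. field_at cutoff x l m \<psi> s n K)" for \<psi> s n K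
  proof -
    have "(\<Sum>i\<in>UNIV. F i) = (\<Sum>l\<in>UNIV. \<Sum>m\<in>UNIV. F (l, m))" for F :: "'n \<times> 3 \<Rightarrow> complex"
      by (simp add: sum.cartesian_product)
    then show ?thesis
      unfolding coupling_def field .
  qed
  have kinetic: "tensor_op (dGamma mult_abs) (mat 1) \<psi> s n K = of_real (photon_energy n K) * \<psi> s n K"
    for \<psi> :: "'n state" and s n K
  proof -
    have "tensor_op (dGamma mult_abs) (mat 1) \<psi> s n K =
        (\<Sum>t\<in>UNIV. of_bool (s = t) * (of_real (photon_energy n K) * \<psi> t n K))"
      unfolding tensor_op_def dGamma_mult_abs by (intro sum.cong refl) (simp add: mat_def)
    then show ?thesis by simp
  qed
  have T: "(\<Sum>t\<in>UNIV. T s t * \<psi> t n K) =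
      (\<Sum>t\<in>UNIV. S $ s $ t * \<psi> t n K) + of_real (real CARD('n) * norm \<beta>) * \<psi> s n K"
    for \<psi> :: "'n state" and s n K
  proof -
    have "(\<Sum>t\<in>UNIV. of_real (real CARD('n) * norm \<beta>) * of_bool (s = t) * \<psi> t n K) =
        of_real (real CARD('n) * norm \<beta>) * \<psi> s n K"
      by (simp only: mult.assoc sum_distrib_left[symmetric]) simp
    then show ?thesis
      unfolding T_def by (simp only: distrib_right sum.distrib)
  qed
  have in_space: "\<psi> \<in> states \<Longrightarrow> \<psi> \<in> state_space" for \<psi>
    by (simp add: states_def state_space_def regular_fock_space)
  have in_domain: "\<psi> \<in> hamiltonian_domain cutoff x" if \<psi>: "\<psi> \<in> states" and free: "free \<psi> \<in> states" for \<psi>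
  proof -
    \<comment> \<open>The kinetic term is recovered as \<open>free \<psi>\<close> minus the bounded
      spin part, so no decay of \<open>\<psi>\<close> at high energy has to be shown.\<close>
    have "tensor_op (dGamma mult_abs) (mat 1) \<psi> s \<in> regular" for s
    proof -
      have "tensor_op (dGamma mult_abs) (mat 1) \<psi> s =
          (\<lambda>n K. free \<psi> s n K + (-1) * (\<Sum>t\<in>UNIV. T s t * \<psi> t n K))"
        by (intro ext) (simp add: kinetic free_def)
      also have "\<dots> \<in> regular"
        by (intro regular_add regular_scale regular_sum states_regular \<psi> free)
      finally show ?thesis .
    qed
    moreover have "field_at cutoff x l m \<psi> s \<in> regular" for l m s
      unfolding field by (intro regular_sum regular_scale regular_segal form_factor states_regular \<psi> UNIV_I)
    ultimately show ?thesis
      using \<psi> by (simp add: hamiltonian_domain_def in_space states_def)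
  qed
  \<comment> \<open>The eigenvalue series is even in \<open>sqrt h\<close> and carries an overall
    factor \<open>h\<close>, so \<open>corr (2 * q)\<close> belongs to \<open>h ^ (q + 1)\<close>.
    For \<open>i = 1\<close> it is 0, and the spin ground state energy takes its place.\<close>
  define lam where "lam i = (if i = 1 then - real CARD('n) * norm \<beta> else Re (corr (2 * (i - 1))))" for i
  have partial_state: "partial_state pert J h = (\<Sum>j\<le>J. scale_state (of_real (sqrt h) ^ j) (pert j))"
    if "0 < h" for J h
    by (intro ext) (simp add: partial_state_def sum_state_apply powr_half_nat[OF that])
  have energy: "of_real (\<Sum>i=1..p+1. lam i * h ^ i) =
      of_real h * (of_real (- real CARD('n) * norm \<beta>) + (\<Sum>i\<le>J. corr i * of_real (sqrt h) ^ i))"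
    if h: "0 < h" and J: "J = 2 * p \<or> J = 2 * p + 1" for h p J
  proof -
    have s: "(of_real (sqrt h))\<^sup>2 = (of_real h :: complex)"
      using h by (simp add: of_real_power[symmetric] del: of_real_power)
    have corr: "corr i = of_real (Re (corr i))" for i
      using corr_real[of i] by (simp add: of_real_Re)
    have lam_sum: "(\<Sum>i=1..p+1. lam i * h ^ i) =
        h * (- real CARD('n) * norm \<beta> + (\<Sum>q\<le>p. Re (corr (2 * q)) * h ^ q))"
    proof -
      have "(\<Sum>i=1..p+1. lam i * h ^ i) =
          (\<Sum>q\<le>p. (if q = 0 then - real CARD('n) * norm \<beta> * h else 0) + h * (Re (corr (2 * q)) * h ^ q))"
        unfolding One_nat_def sum.atLeast1_atMost_eq[unfolded One_nat_def]
        by (rule sum.cong) (auto simp: lam_def)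
      then show ?thesis
        by (simp add: sum.distrib sum_distrib_left right_diff_distrib)
    qed
    \<comment> \<open>Because \<open>corr (2 * p + 1) = 0\<close>, both truncations of the vector go
      with the same energy polynomial.\<close>
    have "(\<Sum>i\<le>J. corr i * of_real (sqrt h) ^ i) = (\<Sum>i\<le>Suc (2 * p). corr i * of_real (sqrt h) ^ i)"
      using J by (auto simp: corr_odd)
    also have "\<dots> = (\<Sum>q\<le>p. corr (2 * q) * of_real h ^ q)"
      unfolding sum_corr_even s ..
    also have "\<dots> = of_real (\<Sum>q\<le>p. Re (corr (2 * q)) * h ^ q)"
      using corr by simp
    finally show ?thesis
      unfolding lam_sum by (simp only: of_real_mult of_real_add)
  qed
  have bound: "\<exists>C. \<forall>h\<in>{0<..<1}. partial_state pert J h \<in> hamiltonian_domain cutoff x \<and>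
      residual cutoff \<beta> x h (\<Sum>i=1..p+1. lam i * h ^ i) (partial_state pert J h) \<in> state_space \<and>
      state_norm (residual cutoff \<beta> x h (\<Sum>i=1..p+1. lam i * h ^ i) (partial_state pert J h))
        \<le> C * h powr (1 + real (Suc J) / 2)"
    if J: "J = 2 * p \<or> J = 2 * p + 1" for J p
  proof -
    obtain C N where CN: "\<And>h s :: real. \<And>\<sigma>. 0 \<le> s \<Longrightarrow> s \<le> 1 \<Longrightarrow> 0 \<le> h \<Longrightarrow> dominated (h * s ^ Suc J * C) N
      (scale_state (of_real h)
      (free (\<Sum>j\<le>J. scale_state (of_real s ^ j) (pert j)) +
       scale_state (of_real s) (coupling (\<Sum>j\<le>J. scale_state (of_real s ^ j) (pert j))) -
       scale_state (\<Sum>i\<le>J. corr i * of_real s ^ i) (\<Sum>j\<le>J. scale_state (of_real s ^ j) (pert j))) \<sigma>)"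
      using residual_dominated[where J = J] by blast
    let ?G = "sqrt (real CARD('n \<Rightarrow> 2) * (\<Sum>n\<le>N. (\<integral>q. (radial_weight cutoff q)\<^sup>2 \<partial>photon_measure) ^ n))"
    show ?thesis
    proof (intro exI[of _ "C * ?G"] ballI)
      fix h :: real assume "h \<in> {0<..<1}"
      then have h: "0 < h" "h < 1" by auto
      let ?\<psi> = "partial_state pert J h" and ?s = "complex_of_real (sqrt h)"
      let ?r = "residual cutoff \<beta> x h (\<Sum>i=1..p+1. lam i * h ^ i) ?\<psi>"
      have \<psi>: "?\<psi> \<in> states"
        unfolding partial_state[OF h(1)] by (intro X_sum X_simps pert_in)
      have free: "free ?\<psi> \<in> states"
        unfolding partial_state[OF h(1)] A_sum A_scale by (intro X_sum X_simps A_pert_in)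
      have r: "?r = scale_state (of_real h) (free ?\<psi> + scale_state ?s (coupling ?\<psi>) -
          scale_state (\<Sum>i\<le>J. corr i * ?s ^ i) ?\<psi>)"
      proof (intro ext)
        fix s n K
        \<comment> \<open>This extracts the common factor \<open>h\<close>. The shift contained in
          \<open>T\<close> then cancels the first-order energy, leaving the residual of
          \<open>free\<close> and \<open>coupling\<close>.\<close>
        have "of_real (h powr (3/2)) = of_real h * ?s"
          using h(1) powr_add[of h 1 "1/2"] by (simp add: powr_half_sqrt)
        then show "?r s n K = scale_state (of_real h) (free ?\<psi> + scale_state ?s (coupling ?\<psi>) -
            scale_state (\<Sum>i\<le>J. corr i * ?s ^ i) ?\<psi>) s n K"
          unfolding residual_def hamiltonian_def energy[OF h(1) J] kinetic coupling[symmetric]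
            S_def[symmetric]
          by (simp add: tensor_op_def free_def T algebra_simps)
      qed
      have "dominated (h * sqrt h ^ Suc J * C) N (?r s)" for s
        unfolding r unfolding partial_state[OF h(1)] by (rule CN) (use h in auto)
      then have "state_norm ?r \<le> h * sqrt h ^ Suc J * C * ?G"
        by (rule state_norm_le)
      also have "h * sqrt h ^ Suc J = h powr (1 + real (Suc J) / 2)"
        unfolding powr_add powr_half_nat[OF h(1)] using h(1) by simp
      also have "h powr (1 + real (Suc J) / 2) * C * ?G = C * ?G * h powr (1 + real (Suc J) / 2)"
        by (simp only: mult_ac)
      finally have "state_norm ?r \<le> C * ?G * h powr (1 + real (Suc J) / 2)" .
      moreover have "?r \<in> state_space"
        unfolding r by (intro in_space X_simps free coupling_in \<psi>)
      ultimately show "?\<psi> \<in> hamiltonian_domain cutoff x \<and> ?r \<in> state_space \<and>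
          state_norm ?r \<le> C * ?G * h powr (1 + real (Suc J) / 2)"
        using in_domain[OF \<psi> free] by blast
    qed
  qed
  show ?thesis
  proof (rule exI[of _ pert], rule exI[of _ lam], intro conjI allI)
    show "pert j \<in> hamiltonian_domain cutoff x" for j
      by (intro in_domain pert_in A_pert_in)
    show "pert 0 = tensor_vec vacuum (spin_power b0)"
      by (intro ext) (simp add: ground_def tensor_vec_def V0)
    show "lam 1 = - real CARD('n) * norm \<beta>"
      by (simp add: lam_def)
    fix p :: nat
    obtain C1 where C1: "\<forall>h\<in>{0<..<1}. partial_state pert (2 * p) h \<in> hamiltonian_domain cutoff x \<and>
      residual cutoff \<beta> x h (\<Sum>i=1..p+1. lam i * h ^ i) (partial_state pert (2 * p) h) \<in> state_space \<and>
      state_norm (residual cutoff \<beta> x h (\<Sum>i=1..p+1. lam i * h ^ i) (partial_state pert (2 * p) h))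
        \<le> C1 * h powr (1 + real (Suc (2 * p)) / 2)"
      using bound[of "2 * p" p] by auto
    obtain C2 where C2: "\<forall>h\<in>{0<..<1}. partial_state pert (2 * p + 1) h \<in> hamiltonian_domain cutoff x \<and>
      residual cutoff \<beta> x h (\<Sum>i=1..p+1. lam i * h ^ i) (partial_state pert (2 * p + 1) h) \<in> state_space \<and>
      state_norm (residual cutoff \<beta> x h (\<Sum>i=1..p+1. lam i * h ^ i) (partial_state pert (2 * p + 1) h))
        \<le> C2 * h powr (1 + real (Suc (2 * p + 1)) / 2)"
      using bound[of "2 * p + 1" p] by auto
    have exponent: "1 + real (Suc (2 * p)) / 2 = real p + 3/2" "1 + real (Suc (2 * p + 1)) / 2 = real p + 2"
      by (simp_all add: field_simps)
    have le: "C1 * h powr a \<le> max C1 C2 * h powr a" "C2 * h powr a \<le> max C1 C2 * h powr a" for h a :: real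
      by (auto intro: mult_right_mono)
    show "\<exists>C. \<forall>h\<in>{0<..<1}.
      (let E = (\<Sum>i=1..p+1. lam i * h ^ i);
           \<psi> = partial_state pert (2 * p) h;
           \<psi>' = partial_state pert (2 * p + 1) h
       in \<psi> \<in> hamiltonian_domain cutoff x \<and> \<psi>' \<in> hamiltonian_domain cutoff x \<and>
          residual cutoff \<beta> x h E \<psi> \<in> state_space \<and>
          state_norm (residual cutoff \<beta> x h E \<psi>) \<le> C * h powr (real p + 3/2) \<and>
          residual cutoff \<beta> x h E \<psi>' \<in> state_space \<and>
          state_norm (residual cutoff \<beta> x h E \<psi>') \<le> C * h powr (real p + 2))"
      unfolding Let_def
      using C1[unfolded exponent] C2[unfolded exponent] le
      by (intro exI[of _ "max C1 C2"]) (blast intro: order_trans)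
  qed
qed

end
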